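(* Let $\mathfrak T$ be the class of closed triangles in $[0,1]^2$, where the degenerate cases of line segments and single points are included. Then $\mathrm{XC}_2|_{\mathfrak T}\not\le_{\mathrm W}\mathrm{XC}_1\times\mathrm{XC}_1$.
   Context: A represented space $\mathbf X$ is a set $X$ with a partial surjection $\delta_{\mathbf X}:\subseteq\mathbb N^{\mathbb N}\to X$ (a $p$ with $\delta_{\mathbf X}(p)=x$ is a name of $x$). A realizer of a (partial) multivalued function $f:\subseteq\mathbf X\rightrightarrows\mathbf Y$ is a partial $F:\subseteq\mathbb N^{\mathbb N}\to\mathbb N^{\mathbb N}$ with $\delta_{\mathbf Y}(F(p))\in f(\delta_{\mathbf X}(p))$ for all names $p$ of points of $\mathrm{dom}(f)$; write $F\vdash f$. Weihrauch reducibility: $f\le_{\mathrm W}g$ iff there are computable $H,K:\subseteq\mathbb N^{\mathbb N}\to\mathbb N^{\mathbb N}$ such that $(p\mapsto K\langle p,GH(p)\rangle)\vdash f$ for every $G\vdash g$. The product is $(f\times g)(x,u)=f(x)\times g(u)$. $\mathcal A(\mathbf X)$ is the represented space of closed subsets of $\mathbf X$ with negative information: a name of $A$ is a name of the open set $X\setminus A$ (its continuous characteristic function into Sierpiński space). Closed choice $\mathrm C_{\mathbf X}:\subseteq\mathcal A(\mathbf X)\rightrightarrows\mathbf X$ maps a non-empty closed set $A$ to an arbitrary point of $A$. $\mathrm{XC}_n$ is the restriction of $\mathrm C_{[0,1]^n}$ to (non-empty closed) convex sets, and $\mathrm{XC}_2|_{\mathfrak T}$ is its further restriction (for $n=2$)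 to inputs belonging to $\mathfrak T$. *)

theory Defs
  imports "HOL-Analysis.Analysis" "HOL-Library.Nat_Bijection"
begin

section \<open>Computability on Baire space\<close>

type_synonym baire = "nat \<Rightarrow> nat"

text \<open>
  Partial recursive functionals: the partial functions of one number that are recursive relative
  to an oracle, uniformly in the oracle \<open>p\<close>. Several arguments are passed through the pairing
  \<^const>\<open>prod_encode\<close>, so the projections and the pairing operation appear among the generators.
  Composition and pairing are strict, and unbounded search diverges as soon as it meets an
  undefined value.
\<close>

inductive recursive_functional :: "(baire \<Rightarrow> nat \<Rightarrow> nat option) \<Rightarrow> bool" where
  zero: "recursive_functional (\<lambda>p n. Some 0)"
| succ: "recursive_functional (\<lambda>p n. Some (Suc n))"
| left: "recursive_functional (\<lambda>p n. Some (fst (prod_decode n)))"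
| right: "recursive_functional (\<lambda>p n. Some (snd (prod_decode n)))"
| oracle_query: "recursive_functional (\<lambda>p n. Some (p n))"
| pair: "recursive_functional f \<Longrightarrow> recursive_functional g \<Longrightarrow>
    recursive_functional (\<lambda>p n. Option.bind (f p n) (\<lambda>a.
      Option.bind (g p n) (\<lambda>b. Some (prod_encode (a, b)))))"
| comp: "recursive_functional f \<Longrightarrow> recursive_functional g \<Longrightarrow>
    recursive_functional (\<lambda>p n. Option.bind (g p n) (f p))"
| prim_rec: "recursive_functional f \<Longrightarrow> recursive_functional g \<Longrightarrow>
    recursive_functional (\<lambda>p n. case prod_decode n of (a, k) \<Rightarrow>
      rec_nat (f p a)
        (\<lambda>i r. Option.bind r (\<lambda>v. g p (prod_encode (a, prod_encode (i, v))))) k)"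
| search: "recursive_functional f \<Longrightarrow>
    recursive_functional (\<lambda>p n.
      if \<exists>k. f p (prod_encode (n, k)) = Some 0 \<and>
             (\<forall>i<k. \<exists>v. f p (prod_encode (n, i)) = Some (Suc v))
      then Some (LEAST k. f p (prod_encode (n, k)) = Some 0)
      else None)"

text \<open>
  The values of \<open>F\<close> on its domain have to be computed; nothing is required outside the domain.
\<close>

definition computable :: "(baire \<rightharpoonup> baire) \<Rightarrow> bool" where
  "computable F \<longleftrightarrow> (\<exists>\<Phi>. recursive_functional \<Phi> \<and>
     (\<forall>p q. F p = Some q \<longrightarrow> (\<forall>n. \<Phi> p n = Some (q n))))"

definition baire_pair :: "baire \<Rightarrow> baire \<Rightarrow> baire" where
  "baire_pair p q n = (if even n then p (n div 2) else q (n div 2))"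

definition baire_fst :: "baire \<Rightarrow> baire" where
  "baire_fst p n = p (2 * n)"

definition baire_snd :: "baire \<Rightarrow> baire" where
  "baire_snd p n = p (2 * n + 1)"

lemma baire_fst_pair [simp]: "baire_fst (baire_pair p q) = p"
  by (rule ext) (simp add: baire_fst_def baire_pair_def)

lemma baire_snd_pair [simp]: "baire_snd (baire_pair p q) = q"
  by (rule ext) (simp add: baire_snd_def baire_pair_def)

lemma baire_pair_collapse [simp]: "baire_pair (baire_fst r) (baire_snd r) = r"
  by (rule ext) (auto simp: baire_fst_def baire_snd_def baire_pair_def)


section \<open>Represented spaces\<close>

text \<open>
  A represented space is given by its representation \<open>\<delta>\<close>. The underlying set is \<open>ran \<delta>\<close>, so
  surjectivity onto the space holds by construction.
\<close>

type_synonym 'a rep = "baire \<rightharpoonup> 'a"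

definition prod_rep :: "'a rep \<Rightarrow> 'b rep \<Rightarrow> ('a \<times> 'b) rep" where
  "prod_rep \<delta> \<epsilon> r = Option.bind (\<delta> (baire_fst r)) (\<lambda>x.
     Option.bind (\<epsilon> (baire_snd r)) (\<lambda>y. Some (x, y)))"

definition subspace_rep :: "'a rep \<Rightarrow> 'a set \<Rightarrow> 'a rep" where
  "subspace_rep \<delta> S p = Option.bind (\<delta> p) (\<lambda>x. if x \<in> S then Some x else None)"

definition sierpinski_rep :: "bool rep" where
  "sierpinski_rep p = Some (\<exists>n. p n \<noteq> 0)"

text \<open>
  Application in Kleene's second algebra: \<open>p\<close> acts as a neighbourhood function. The value
  \<open>(p \<cdot> q)(n)\<close> is \<open>k\<close> if \<open>p\<close> answers \<open>k + 1\<close> on \<open>n\<close> together with the shortest prefix of \<open>q\<close> on which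
  the answer is nonzero. Every continuous partial function on Baire space extends to one of the
  form \<open>q \<mapsto> p \<cdot> q\<close>, and a name of a continuous map between represented spaces is a \<open>p\<close> such that
  \<open>q \<mapsto> p \<cdot> q\<close> realizes it.
\<close>

definition kleene_query :: "baire \<Rightarrow> baire \<Rightarrow> nat \<Rightarrow> nat \<Rightarrow> nat" where
  "kleene_query p q n m = p (list_encode (n # map q [0..<m]))"

definition kleene_app :: "baire \<Rightarrow> baire \<rightharpoonup> baire" where
  "kleene_app p q =
     (if \<forall>n. \<exists>m. kleene_query p q n m \<noteq> 0
      then Some (\<lambda>n. kleene_query p q n (LEAST m. kleene_query p q n m \<noteq> 0) - 1)
      else None)"

text \<open>Points of the function space are maps whose domain is exactly the source space.\<close>

definition continuous_name :: "'a rep \<Rightarrow> 'b rep \<Rightarrow> baire \<Rightarrow> ('a \<rightharpoonup> 'b) \<Rightarrow> bool" where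
  "continuous_name \<delta> \<epsilon> p f \<longleftrightarrow> dom f = ran \<delta> \<and>
     (\<forall>q x. \<delta> q = Some x \<longrightarrow>
        (\<exists>r y. kleene_app p q = Some r \<and> \<epsilon> r = Some y \<and> f x = Some y))"

definition function_rep :: "'a rep \<Rightarrow> 'b rep \<Rightarrow> ('a \<rightharpoonup> 'b) rep" where
  "function_rep \<delta> \<epsilon> p =
     (if \<exists>f. continuous_name \<delta> \<epsilon> p f then Some (THE f. continuous_name \<delta> \<epsilon> p f) else None)"

lemma continuous_name_unique:
  assumes f: "continuous_name \<delta> \<epsilon> p f" and g: "continuous_name \<delta> \<epsilon> p g"
  shows "f = g"
proof
  fix x
  show "f x = g x"
  proof (cases "x \<in> ran \<delta>")
    case True
    then obtain q where "\<delta> q = Some x" by (auto simp: ran_def)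
    with f g show ?thesis by (fastforce simp: continuous_name_def)
  next
    case False
    with f g have "x \<notin> dom f" "x \<notin> dom g" by (auto simp: continuous_name_def)
    then show ?thesis by (simp add: domIff)
  qed
qed

lemma function_rep_eq_Some_iff: "function_rep \<delta> \<epsilon> p = Some f \<longleftrightarrow> continuous_name \<delta> \<epsilon> p f"
proof -
  have "(THE f. continuous_name \<delta> \<epsilon> p f) = f" if "continuous_name \<delta> \<epsilon> p f" for f
    using that by (blast intro: the_equality continuous_name_unique)
  then show ?thesis by (auto simp: function_rep_def)
qed

definition open_rep :: "'a rep \<Rightarrow> 'a set rep" where
  "open_rep \<delta> p = map_option (\<lambda>f. {x. f x = Some True}) (function_rep \<delta> sierpinski_rep p)"

definition closed_rep :: "'a rep \<Rightarrow> 'a set rep" where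
  "closed_rep \<delta> p = map_option (\<lambda>U. ran \<delta> - U) (open_rep \<delta> p)"


section \<open>The unit interval and the unit square\<close>

definition rat_code :: "nat \<Rightarrow> real" where
  "rat_code n = (case prod_decode n of (a, b) \<Rightarrow> of_int (int_decode a) / real (Suc b))"

definition cauchy_name :: "baire \<Rightarrow> real \<Rightarrow> bool" where
  "cauchy_name p x \<longleftrightarrow> (\<forall>k. \<bar>rat_code (p k) - x\<bar> \<le> (1/2) ^ k)"

definition real_rep :: "real rep" where
  "real_rep p = (if \<exists>x. cauchy_name p x then Some (THE x. cauchy_name p x) else None)"

definition unit_interval :: "real rep" where
  "unit_interval = subspace_rep real_rep {0..1}"

definition unit_square :: "(real \<times> real) rep" where
  "unit_square = prod_rep unit_interval unit_interval"

lemma cauchy_name_unique: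
  assumes x: "cauchy_name p x" and y: "cauchy_name p y"
  shows "x = y"
proof -
  have "(\<lambda>k. rat_code (p k)) \<longlonglongrightarrow> z" if "cauchy_name p z" for z
  proof (rule LIM_zero_cancel, rule Lim_null_comparison)
    show "\<forall>\<^sub>F k in sequentially. norm (rat_code (p k) - z) \<le> (1/2) ^ k"
      using that by (simp add: cauchy_name_def)
    show "(\<lambda>k. (1/2::real) ^ k) \<longlonglongrightarrow> 0"
      by (rule LIMSEQ_realpow_zero) auto
  qed
  with x y show ?thesis using LIMSEQ_unique by blast
qed

lemma real_rep_eq_Some_iff: "real_rep p = Some x \<longleftrightarrow> cauchy_name p x"
proof -
  have "(THE x. cauchy_name p x) = x" if "cauchy_name p x" for x
    using that by (blast intro: the_equality cauchy_name_unique)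
  then show ?thesis by (auto simp: real_rep_def)
qed

lemma unit_interval_eq_Some_iff:
  "unit_interval p = Some x \<longleftrightarrow> cauchy_name p x \<and> x \<in> {0..1}"
  by (auto simp: unit_interval_def subspace_rep_def bind_eq_Some_conv real_rep_eq_Some_iff
      split: if_splits)

lemma rat_code_surj:
  assumes "r \<in> \<rat>"
  obtains n where "rat_code n = r"
proof -
  from assms obtain a b :: int where ab: "b > 0" "r = of_int a / of_int b"
    by (auto elim: Rats_cases')
  have "rat_code (prod_encode (int_encode a, nat (b - 1))) = r"
    using ab by (simp add: rat_code_def)
  then show thesis by (rule that)
qed

lemma cauchy_name_exists: "\<exists>p. cauchy_name p x"
proof -
  have "\<exists>n. \<bar>rat_code n - x\<bar> \<le> (1/2) ^ k" for k
  proof -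
    obtain r where "r \<in> \<rat>" "x < r" "r < x + (1/2) ^ k"
      using Rats_dense_in_real[of x "x + (1/2) ^ k"] by auto
    then show ?thesis by (metis rat_code_surj abs_of_pos diff_gt_0_iff_gt less_eq_real_def
          add.commute diff_less_eq)
  qed
  then show ?thesis unfolding cauchy_name_def by metis
qed

lemma ran_unit_interval: "ran unit_interval = {0..1}"
  using cauchy_name_exists by (auto simp: ran_def unit_interval_eq_Some_iff)

lemma ran_prod_rep: "ran (prod_rep \<delta> \<epsilon>) = ran \<delta> \<times> ran \<epsilon>"
proof (rule set_eqI)
  fix z :: "'a \<times> 'b"
  obtain x y where z: "z = (x, y)" by fastforce
  have "z \<in> ran \<delta> \<times> ran \<epsilon> \<Longrightarrow> z \<in> ran (prod_rep \<delta> \<epsilon>)"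
  proof -
    assume "z \<in> ran \<delta> \<times> ran \<epsilon>"
    then obtain p q where "\<delta> p = Some x" "\<epsilon> q = Some y" by (auto simp: z ran_def)
    then have "prod_rep \<delta> \<epsilon> (baire_pair p q) = Some z" by (simp add: prod_rep_def z)
    then show ?thesis by (auto simp: ran_def)
  qed
  moreover have "z \<in> ran (prod_rep \<delta> \<epsilon>) \<Longrightarrow> z \<in> ran \<delta> \<times> ran \<epsilon>"
    by (auto simp: z ran_def prod_rep_def bind_eq_Some_conv)
  ultimately show "z \<in> ran (prod_rep \<delta> \<epsilon>) \<longleftrightarrow> z \<in> ran \<delta> \<times> ran \<epsilon>" by blast
qed

lemma ran_unit_square: "ran unit_square = {0..1} \<times> {0..1}"
  by (simp add: unit_square_def ran_prod_rep ran_unit_interval)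


section \<open>Weihrauch reducibility\<close>

text \<open>
  A partial multivalued function between represented spaces. It is undefined where its value is
  the empty set.
\<close>

record ('a, 'b) problem =
  source :: "'a rep"
  target :: "'b rep"
  solutions :: "'a \<Rightarrow> 'b set"

definition problem_dom :: "('a, 'b) problem \<Rightarrow> 'a set" where
  "problem_dom f = {x \<in> ran (source f). solutions f x \<noteq> {}}"

definition realizes :: "(baire \<rightharpoonup> baire) \<Rightarrow> ('a, 'b) problem \<Rightarrow> bool" (infix "\<turnstile>" 50) where
  "F \<turnstile> f \<longleftrightarrow> (\<forall>p x. source f p = Some x \<and> x \<in> problem_dom f \<longrightarrow>
     (\<exists>q y. F p = Some q \<and> target f q = Some y \<and> y \<in> solutions f x))"

definition weihrauch_le :: "('a, 'b) problem \<Rightarrow> ('c, 'd) problem \<Rightarrow> bool" (infix "\<le>\<^sub>W" 50) where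
  "f \<le>\<^sub>W g \<longleftrightarrow> (\<exists>H K. computable H \<and> computable K \<and>
     (\<forall>G. G \<turnstile> g \<longrightarrow>
        (\<lambda>p. Option.bind (H p) (\<lambda>h. Option.bind (G h) (\<lambda>r. K (baire_pair p r)))) \<turnstile> f))"

definition problem_prod ::
  "('a, 'b) problem \<Rightarrow> ('c, 'd) problem \<Rightarrow> ('a \<times> 'c, 'b \<times> 'd) problem" (infixr "\<times>\<^sub>W" 70) where
  "f \<times>\<^sub>W g = \<lparr>source = prod_rep (source f) (source g), target = prod_rep (target f) (target g),
     solutions = (\<lambda>(x, u). solutions f x \<times> solutions g u)\<rparr>"

definition problem_restrict :: "('a, 'b) problem \<Rightarrow> 'a set \<Rightarrow> ('a, 'b) problem" where
  "problem_restrict f D = f\<lparr>solutions := (\<lambda>x. if x \<in> D then solutions f x else {})\<rparr>"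


section \<open>Convex choice\<close>

definition closed_choice :: "'a rep \<Rightarrow> ('a set, 'a) problem" where
  "closed_choice \<delta> = \<lparr>source = closed_rep \<delta>, target = \<delta>, solutions = (\<lambda>A. A)\<rparr>"

definition convex_choice :: "'a::real_vector rep \<Rightarrow> ('a set, 'a) problem" where
  "convex_choice \<delta> = problem_restrict (closed_choice \<delta>) {A. convex A}"

abbreviation XC\<^sub>1 :: "(real set, real) problem" where
  "XC\<^sub>1 \<equiv> convex_choice unit_interval"

abbreviation XC\<^sub>2 :: "((real \<times> real) set, real \<times> real) problem" where
  "XC\<^sub>2 \<equiv> convex_choice unit_square"

text \<open>The vertices need not be distinct or affinely independent.\<close>

definition triangles :: "(real \<times> real) set set" where
  "triangles = {convex hull {a, b, c} | a b c. {a, b, c} \<subseteq> {0..1} \<times> {0..1}}"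

end

theory Submission
  imports Defs "HOL-Complex_Analysis.Great_Picard"
begin

text \<open>
  Only the continuity of the two reduction functions matters. The inner one turns a shrinking
  triangle into a shrinking rectangle \<open>Q\<close>, a product of two intervals. Averaging the outer one
  over the names of a point, which convexity of the triangle permits, gives a continuous
  single-valued \<open>f\<close> from \<open>Q\<close> into the triangle.

  Fix the name of a large triangle and its \<open>f\<close>. Shrinking this triangle late to the triangle \<open>T v\<close>
  over a fixed base with apex \<open>v\<close> gives a rectangle \<open>Q v\<close> with \<open>f ` Q v \<subseteq> T v\<close>; shrinking further
  to the segments that join \<open>v\<close> to points of the base gives subrectangles of \<open>Q v\<close> whose images lie
  on these segments and reach both ends, \<open>v\<close> being reached at points \<open>z i v\<close>. As \<open>v \<notin> T w\<close> for
  apexes \<open>w \<noteq> v\<close>, no \<open>z i v\<close> lies in \<open>Q w\<close>. But along a convergent sequence of apexes the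
  rectangles converge, and then \<open>z i v \<in> Q w\<close> or \<open>z i w \<in> Q v\<close> for late \<open>v\<close> and \<open>w\<close>, unless the
  limit of \<open>z i v\<close> is a corner of the limit rectangle. A rectangle has too few corners for this to
  happen for all the segments.
\<close>

section \<open>Convergence in Baire space\<close>

text \<open>Convergence in the product topology of discrete copies of \<open>nat\<close>. Continuity
  on Baire space is handled sequentially throughout.\<close>

definition baire_conv :: "(nat \<Rightarrow> baire) \<Rightarrow> baire \<Rightarrow> bool" where
  "baire_conv X p \<longleftrightarrow> (\<forall>k. \<forall>\<^sub>F n in sequentially. X n k = p k)"

lemma baire_convD: "baire_conv X p \<Longrightarrow> \<forall>\<^sub>F n in sequentially. X n k = p k"
  by (simp add: baire_conv_def)

lemma baire_conv_fst: "baire_conv X p \<Longrightarrow> baire_conv (\<lambda>n. baire_fst (X n)) (baire_fst p)"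
  and baire_conv_snd: "baire_conv X p \<Longrightarrow> baire_conv (\<lambda>n. baire_snd (X n)) (baire_snd p)"
  by (simp_all add: baire_conv_def baire_fst_def baire_snd_def)

lemma baire_conv_pair:
  "baire_conv X p \<Longrightarrow> baire_conv Y q \<Longrightarrow> baire_conv (\<lambda>n. baire_pair (X n) (Y n)) (baire_pair p q)"
  by (simp add: baire_conv_def baire_pair_def)

text \<open>A converging computation reads only finitely many oracle values, so every oracle close
  enough to \<open>p\<close> yields the same result. For \<open>search\<close> only the finitely
  many tests up to the first zero matter.\<close>

lemma recursive_functional_continuous:
  assumes "recursive_functional \<Phi>" "baire_conv X p" "\<Phi> p n = Some v"
  shows "\<forall>\<^sub>F m in sequentially. \<Phi> (X m) n = Some v"
  using assms(1,3)
proof (induction arbitrary: n v rule: recursive_functional.induct)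
  case oracle_query
  then show ?case using baire_convD[OF assms(2), of n] by simp
next
  case (pair f g)
  from pair.prems obtain a b where ab: "f p n = Some a" "g p n = Some b" "v = prod_encode (a, b)"
    by (auto simp: bind_eq_Some_conv)
  show ?case using pair.IH(1)[OF ab(1)] pair.IH(2)[OF ab(2)]
    by eventually_elim (simp add: ab)
next
  case (comp f g)
  from comp.prems obtain a where a: "g p n = Some a" "f p a = Some v"
    by (auto simp: bind_eq_Some_conv)
  show ?case using comp.IH(2)[OF a(1)] comp.IH(1)[OF a(2)]
    by eventually_elim simp
next
  case (prim_rec f g)
  obtain a k where n: "prod_decode n = (a, k)" by fastforce
  let ?R = "\<lambda>p. rec_nat (f p a) (\<lambda>i r. Option.bind r (\<lambda>v. g p (prod_encode (a, prod_encode (i, v)))))"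
  have "?R p k = Some w \<Longrightarrow> \<forall>\<^sub>F m in sequentially. ?R (X m) k = Some w" for w
  proof (induction k arbitrary: w)
    case 0
    then show ?case using prim_rec.IH(1) by simp
  next
    case (Suc k)
    then obtain u where u: "?R p k = Some u"
        "g p (prod_encode (a, prod_encode (k, u))) = Some w"
      by (auto simp: bind_eq_Some_conv)
    show ?case using Suc.IH[OF u(1)] prim_rec.IH(2)[OF u(2)]
      by eventually_elim simp
  qed
  with prim_rec.prems n show ?case by simp
next
  case (search f)
  let ?P = "\<lambda>p k. f p (prod_encode (n, k)) = Some 0 \<and>
             (\<forall>i<k. \<exists>v. f p (prod_encode (n, i)) = Some (Suc v))"
  from search.prems obtain k where k: "?P p k" and v: "v = (LEAST k. f p (prod_encode (n, k)) = Some 0)"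
    by (auto split: if_splits)
  have least: "(LEAST k. f q (prod_encode (n, k)) = Some 0) = k" if "?P q k" for q
  proof (rule Least_equality)
    show "k \<le> y" if "f q (prod_encode (n, y)) = Some 0" for y
    proof (rule ccontr)
      assume "\<not> k \<le> y"
      then obtain v where "f q (prod_encode (n, y)) = Some (Suc v)" using \<open>?P q k\<close> not_le by blast
      with that show False by simp
    qed
  qed (use that in blast)
  from k obtain u where u: "\<And>i. i < k \<Longrightarrow> f p (prod_encode (n, i)) = Some (Suc (u i))" by metis
  have "\<forall>\<^sub>F m in sequentially. \<forall>i\<in>{..<k}. f (X m) (prod_encode (n, i)) = Some (Suc (u i))"
    using search.IH[OF u] by (intro eventually_ball_finite) auto
  moreover have "\<forall>\<^sub>F m in sequentially. f (X m) (prod_encode (n, k)) = Some 0"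
    using search.IH k by blast
  ultimately show ?case
  proof eventually_elim
    case (elim m)
    then have "?P (X m) k" by auto
    with least[OF this] v least[OF k] show ?case by (simp only: if_P) (use \<open>?P (X m) k\<close> in auto)
  qed
qed auto

lemma computable_continuous:
  assumes "computable F" "baire_conv X p" "F p = Some q" "\<forall>\<^sub>F n in sequentially. F (X n) = Some (Y n)"
  shows "baire_conv Y q"
  unfolding baire_conv_def
proof
  fix k
  from assms(1) obtain \<Phi> where \<Phi>: "recursive_functional \<Phi>"
      "\<And>p q n. F p = Some q \<Longrightarrow> \<Phi> p n = Some (q n)"
    unfolding computable_def by blast
  have "\<forall>\<^sub>F n in sequentially. \<Phi> (X n) k = Some (q k)"
    using recursive_functional_continuous[OF \<Phi>(1) assms(2)] \<Phi>(2)[OF assms(3)] .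
  with assms(4) show "\<forall>\<^sub>F n in sequentially. Y n k = q k"
    by eventually_elim (use \<Phi>(2) in force)
qed


section \<open>Names of points\<close>

text \<open>Two names that share entry \<open>k\<close> name reals at distance at most
  \<open>2 * (1/2) ^ k\<close>.\<close>

lemma cauchy_name_continuous:
  assumes "baire_conv X p" "cauchy_name p x" "\<forall>\<^sub>F n in sequentially. cauchy_name (X n) (y n)"
  shows "y \<longlonglongrightarrow> x"
proof (rule tendstoI)
  fix e :: real assume "e > 0"
  then obtain k where k: "(1/2) ^ k < e / 2"
    using real_arch_pow_inv[of "e/2" "1/2"] by auto
  from baire_convD[OF assms(1), of k] assms(3) show "\<forall>\<^sub>F n in sequentially. dist (y n) x < e"
  proof eventually_elim
    case (elim n)
    then have "\<bar>rat_code (p k) - y n\<bar> \<le> (1/2) ^ k" "\<bar>rat_code (p k) - x\<bar> \<le> (1/2) ^ k"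
      using assms(2) unfolding cauchy_name_def by metis+
    with k show ?case by (simp add: dist_real_def)
  qed
qed

lemma unit_square_eq_Some_iff:
  "unit_square p = Some z \<longleftrightarrow> unit_interval (baire_fst p) = Some (fst z) \<and> unit_interval (baire_snd p) = Some (snd z)"
  by (cases z) (auto simp: unit_square_def prod_rep_def bind_eq_Some_conv)

lemma unit_square_continuous:
  assumes "baire_conv X p" "unit_square p = Some x"
    "\<forall>\<^sub>F n in sequentially. unit_square (X n) = Some (y n)"
  shows "y \<longlonglongrightarrow> x"
proof -
  have "(\<lambda>n. fst (y n)) \<longlonglongrightarrow> fst x"
    using cauchy_name_continuous[OF baire_conv_fst[OF assms(1)], of "fst x" "\<lambda>n. fst (y n)"] assms(2,3)
    by (simp add: unit_square_eq_Some_iff unit_interval_eq_Some_iff eventually_conj_iff)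
  moreover have "(\<lambda>n. snd (y n)) \<longlonglongrightarrow> snd x"
    using cauchy_name_continuous[OF baire_conv_snd[OF assms(1)], of "snd x" "\<lambda>n. snd (y n)"] assms(2,3)
    by (simp add: unit_square_eq_Some_iff unit_interval_eq_Some_iff eventually_conj_iff)
  ultimately show ?thesis using tendsto_Pair by fastforce
qed

text \<open>A family of names of the same \<open>x\<close>: round after a shift by \<open>t\<close>.
  No rule picks a name of each real continuously, but for each \<open>x\<close> only few shifts make
  a floor jump at \<open>x\<close>. Equal roundings select equal codes, as \<open>SOME\<close> sees
  only the rational.\<close>

definition shifted_name :: "real \<Rightarrow> real \<Rightarrow> baire" where
  "shifted_name t x k = (SOME c. rat_code c = of_int \<lfloor>2 ^ k * x + t\<rfloor> / 2 ^ k)"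

lemma rat_code_shifted_name: "rat_code (shifted_name t x k) = of_int \<lfloor>2 ^ k * x + t\<rfloor> / 2 ^ k"
proof -
  have "(of_int \<lfloor>2 ^ k * x + t\<rfloor> / 2 ^ k :: real) \<in> \<rat>" by simp
  then have "\<exists>c. rat_code c = of_int \<lfloor>2 ^ k * x + t\<rfloor> / 2 ^ k" by (rule rat_code_surj) blast
  then show ?thesis unfolding shifted_name_def by (rule someI_ex)
qed

lemma cauchy_name_shifted_name:
  assumes "t \<in> {0..1}"
  shows "cauchy_name (shifted_name t x) x"
  unfolding cauchy_name_def
proof
  fix k
  have "\<bar>of_int \<lfloor>2 ^ k * x + t\<rfloor> - 2 ^ k * x\<bar> \<le> 1" using assms
    by (auto simp: abs_le_iff) linarith+
  then have "\<bar>of_int \<lfloor>2 ^ k * x + t\<rfloor> - 2 ^ k * x\<bar> / 2 ^ k \<le> 1 / 2 ^ k" by (simp add: divide_right_mono)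
  moreover have "of_int \<lfloor>2 ^ k * x + t\<rfloor> / 2 ^ k - x = (of_int \<lfloor>2 ^ k * x + t\<rfloor> - 2 ^ k * x) / 2 ^ k"
    by (simp add: diff_divide_distrib)
  ultimately show "\<bar>rat_code (shifted_name t x k) - x\<bar> \<le> (1 / 2) ^ k"
    by (simp add: rat_code_shifted_name power_one_over abs_divide)
qed

text \<open>The shifts for which some entry of \<open>shifted_name t x\<close> sits on a jump of the
  floor. They are countable, hence null and unable to fill the unit interval.\<close>

definition bad_shifts :: "real \<Rightarrow> real set" where
  "bad_shifts x = {t. \<exists>k::nat. 2 ^ k * x + t \<in> \<int>}"

lemma countable_bad_shifts: "countable (bad_shifts x)"
proof -
  have "bad_shifts x \<subseteq> (\<Union>k::nat. (\<lambda>z. z - 2 ^ k * x) ` \<int>)"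
  proof
    fix t assume "t \<in> bad_shifts x"
    then obtain k :: nat where "2 ^ k * x + t \<in> \<int>" by (auto simp: bad_shifts_def)
    moreover have "t = (2 ^ k * x + t) - 2 ^ k * x" by simp
    ultimately show "t \<in> (\<Union>k::nat. (\<lambda>z. z - 2 ^ k * x) ` \<int>)" by blast
  qed
  moreover have "countable (\<Union>k::nat. (\<lambda>z. z - 2 ^ k * x) ` (\<int> :: real set))"
    by (intro countable_UN countable_image) (auto simp: Ints_def)
  ultimately show ?thesis by (rule countable_subset)
qed

lemma shifted_name_conv:
  assumes "X \<longlonglongrightarrow> x" "s \<longlonglongrightarrow> t" "t \<notin> bad_shifts x"
  shows "baire_conv (\<lambda>n. shifted_name (s n) (X n)) (shifted_name t x)"
  unfolding baire_conv_def
proof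
  fix k
  have "(\<lambda>n. 2 ^ k * X n + s n) \<longlonglongrightarrow> 2 ^ k * x + t"
    by (intro tendsto_intros assms)
  moreover have "2 ^ k * x + t \<notin> \<int>" using assms(3) by (auto simp: bad_shifts_def)
  ultimately have "\<forall>\<^sub>F n in sequentially. \<lfloor>2 ^ k * X n + s n\<rfloor> = \<lfloor>2 ^ k * x + t\<rfloor>"
    by (rule eventually_floor_eq)
  then show "\<forall>\<^sub>F n in sequentially. shifted_name (s n) (X n) k = shifted_name t x k"
    by eventually_elim (simp add: shifted_name_def)
qed


section \<open>Names of closed sets\<close>

lemma closed_rep_eq_Some_iff:
  "closed_rep \<delta> p = Some A \<longleftrightarrow> A \<subseteq> ran \<delta> \<and>
     (\<forall>q x. \<delta> q = Some x \<longrightarrow> (\<exists>r. kleene_app p q = Some r \<and> (x \<notin> A \<longleftrightarrow> (\<exists>n. r n \<noteq> 0))))"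
    (is "_ \<longleftrightarrow> ?R")
proof
  assume "closed_rep \<delta> p = Some A"
  then obtain f where f: "continuous_name \<delta> sierpinski_rep p f" and A: "A = ran \<delta> - {x. f x = Some True}"
    by (auto simp: closed_rep_def open_rep_def function_rep_eq_Some_iff)
  show ?R
  proof (intro conjI allI impI)
    fix q x assume q: "\<delta> q = Some x"
    with f obtain r y where "kleene_app p q = Some r" "sierpinski_rep r = Some y" "f x = Some y"
      unfolding continuous_name_def by blast
    with q A show "\<exists>r. kleene_app p q = Some r \<and> (x \<notin> A \<longleftrightarrow> (\<exists>n. r n \<noteq> 0))"
      by (auto simp: sierpinski_rep_def ran_def)
  qed (use A in blast)
next
  assume R: ?R
  define f where "f = (\<lambda>x. if x \<in> ran \<delta> then Some (x \<notin> A) else None)"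
  have "continuous_name \<delta> sierpinski_rep p f"
    unfolding continuous_name_def
  proof (intro conjI allI impI)
    show "dom f = ran \<delta>" by (auto simp: f_def dom_def)
    fix q x assume q: "\<delta> q = Some x"
    with R obtain r where "kleene_app p q = Some r" "x \<notin> A \<longleftrightarrow> (\<exists>n. r n \<noteq> 0)" by blast
    with q show "\<exists>r y. kleene_app p q = Some r \<and> sierpinski_rep r = Some y \<and> f x = Some y"
      by (auto simp: sierpinski_rep_def f_def ran_def)
  qed
  then have "function_rep \<delta> sierpinski_rep p = Some f" by (simp add: function_rep_eq_Some_iff)
  with R show "closed_rep \<delta> p = Some A" by (auto simp: closed_rep_def open_rep_def f_def)
qed

lemma closed_rep_subset: "closed_rep \<delta> p = Some A \<Longrightarrow> A \<subseteq> ran \<delta>"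
  by (simp add: closed_rep_eq_Some_iff)

lemma kleene_query_conv:
  assumes "baire_conv X p" "baire_conv Y q"
  shows "\<forall>\<^sub>F n in sequentially. kleene_query (X n) (Y n) k m = kleene_query p q k m"
proof -
  have "\<forall>\<^sub>F n in sequentially. \<forall>i\<in>{..<m}. Y n i = q i"
    using baire_convD[OF assms(2)] by (intro eventually_ball_finite) auto
  with baire_convD[OF assms(1), of "list_encode (k # map q [0..<m])"] show ?thesis
    unfolding kleene_query_def
  proof eventually_elim
    case (elim n)
    have "map (Y n) [0..<m] = map q [0..<m]" using elim(2) by simp
    with elim(1) show ?case by metis
  qed
qed

text \<open>Absence from \<open>A\<close> is detected after finitely many entries of
  \<open>p\<close> and \<open>q\<close>. Late \<open>X n\<close> and \<open>Y n\<close> share these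
  entries and would reject \<open>y n\<close> from \<open>B n\<close>.\<close>

lemma closed_rep_limit:
  assumes X: "baire_conv X p" and Y: "baire_conv Y q"
    and A: "closed_rep \<delta> p = Some A" "\<And>n. closed_rep \<delta> (X n) = Some (B n)"
    and x: "\<delta> q = Some x" "\<And>n. \<delta> (Y n) = Some (y n)" "\<And>n. y n \<in> B n"
  shows "x \<in> A"
proof (rule ccontr)
  assume "x \<notin> A"
  with A(1) x(1) obtain r k where r: "kleene_app p q = Some r" "r k \<noteq> 0"
    unfolding closed_rep_eq_Some_iff by blast
  \<comment> \<open>The prefix length that triggers the rejection. Agreement is needed on all
    shorter prefixes too, so that \<open>LEAST\<close> stops at the same length for the
    approximating names.\<close>
  define m where "m = (LEAST m. kleene_query p q k m \<noteq> 0)"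
  from r have ex: "\<exists>m. kleene_query p q k m \<noteq> 0" and rk: "r k = kleene_query p q k m - 1"
    by (auto simp: kleene_app_def m_def split: if_splits)
  from ex have m: "kleene_query p q k m \<noteq> 0" unfolding m_def by (rule LeastI_ex)
  have "\<forall>\<^sub>F n in sequentially. \<forall>i\<in>{..m}. kleene_query (X n) (Y n) k i = kleene_query p q k i"
    using kleene_query_conv[OF X Y] by (intro eventually_ball_finite) auto
  then obtain n where n: "\<And>i. i \<le> m \<Longrightarrow> kleene_query (X n) (Y n) k i = kleene_query p q k i"
    by (auto simp: eventually_sequentially)
  have "(LEAST i. kleene_query (X n) (Y n) k i \<noteq> 0) = m"
  proof (rule Least_equality)
    show "m \<le> i" if "kleene_query (X n) (Y n) k i \<noteq> 0" for i
    proof (rule ccontr)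
      assume "\<not> m \<le> i"
      with that n[of i] have "kleene_query p q k i \<noteq> 0" by simp
      then have "m \<le> i" unfolding m_def by (rule Least_le)
      with \<open>\<not> m \<le> i\<close> show False by simp
    qed
  qed (use m n in simp)
  with n[of m] rk have *: "r k = kleene_query (X n) (Y n) k (LEAST i. kleene_query (X n) (Y n) k i \<noteq> 0) - 1"
    by simp
  from A(2)[of n] x(2)[of n] obtain r' where r': "kleene_app (X n) (Y n) = Some r'"
      "y n \<notin> B n \<longleftrightarrow> (\<exists>k. r' k \<noteq> 0)"
    unfolding closed_rep_eq_Some_iff by blast
  from r'(1) have "r' k = r k" using * by (auto simp: kleene_app_def split: if_splits)
  with r(2) have "\<exists>k. r' k \<noteq> 0" by (intro exI[of _ k]) simp
  with r'(2) x(3) show False by blast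
qed

text \<open>Undecidable in general, which is harmless: a reduction has to handle every name,
  computable or not.\<close>

definition refuted :: "'a rep \<Rightarrow> 'a set \<Rightarrow> nat list \<Rightarrow> bool" where
  "refuted \<delta> A w \<longleftrightarrow> (\<forall>q x. \<delta> q = Some x \<and> map q [0..<length w] = w \<longrightarrow> x \<notin> A)"

text \<open>
  The entry \<open>c\<close> only depends on \<open>A c\<close>, so \<open>A\<close> can be thought of as a set that shrinks while its
  name is being written.
\<close>

definition shrinking_name :: "'a rep \<Rightarrow> (nat \<Rightarrow> 'a set) \<Rightarrow> baire" where
  "shrinking_name \<delta> A c = (case list_decode c of [] \<Rightarrow> 0
     | n # w \<Rightarrow> if length w < n then 0 else if refuted \<delta> (A c) w then 2 else 1)"

lemma shrinking_name_conv:
  assumes "\<And>k. \<forall>\<^sub>F n in sequentially. A n k = B k"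
  shows "baire_conv (\<lambda>n. shrinking_name \<delta> (A n)) (shrinking_name \<delta> B)"
  unfolding baire_conv_def
proof
  show "\<forall>\<^sub>F n in sequentially. shrinking_name \<delta> (A n) k = shrinking_name \<delta> B k" for k
    using assms[of k]
  proof eventually_elim
    case (elim n)
    then show ?case unfolding shrinking_name_def by (rule ssubst) (rule refl)
  qed
qed

text \<open>Ensures that a query with first entry \<open>n\<close> consults \<open>A\<close> at
  stage \<open>n\<close> or later.\<close>

lemma le_list_encode_Cons: "n \<le> list_encode (n # w)"
  by (simp add: le_prod_encode_1 le_SucI)

text \<open>A point that is never refuted is a limit of points \<open>y n\<close> of
  \<open>A\<close> at stages at least \<open>n\<close>, found below prefixes of its name. Once these
  stages pass \<open>N\<close>, the points lie in the closed set \<open>A N\<close>, which is the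
  intersection. Conversely, a refutation at any stage is final, as every stage contains the
  intersection.\<close>

lemma closed_rep_shrinking_name:
  fixes A :: "nat \<Rightarrow> (real \<times> real) set"
  assumes "antimono A" "\<And>k. closed (A k)" "\<And>k. A k \<subseteq> {0..1} \<times> {0..1}" "A N = (\<Inter>k. A k)"
  shows "closed_rep unit_square (shrinking_name unit_square A) = Some (\<Inter>k. A k)"
  unfolding closed_rep_eq_Some_iff
proof (intro conjI allI impI)
  show "(\<Inter>k. A k) \<subseteq> ran unit_square" using assms(3) by (auto simp: ran_unit_square)
  fix q x assume q: "unit_square q = Some x"
  let ?p = "shrinking_name unit_square A"
  let ?c = "\<lambda>n. list_encode (n # map q [0..<n])"
  have query: "kleene_query ?p q n m = (if m < n then 0 else
      if refuted unit_square (A (list_encode (n # map q [0..<m]))) (map q [0..<m]) then 2 else 1)" for n m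
    by (simp add: kleene_query_def shrinking_name_def del: list_encode.simps)
  \<comment> \<open>The answer 0 on prefixes shorter than \<open>n\<close> makes the application
    read exactly \<open>n\<close> entries for its output \<open>n\<close>.\<close>
  have least: "(LEAST m. kleene_query ?p q n m \<noteq> 0) = n" for n
    by (rule Least_equality) (auto simp: query split: if_splits)
  define r where "r n = (if refuted unit_square (A (?c n)) (map q [0..<n]) then 1 else 0::nat)" for n
  have r: "kleene_app ?p q = Some r"
  proof -
    have "kleene_query ?p q n n \<noteq> 0" for n by (simp add: query del: list_encode.simps)
    then have "\<forall>n. \<exists>m. kleene_query ?p q n m \<noteq> 0" by blast
    moreover have "kleene_query ?p q n n - 1 = r n" for n by (simp add: query r_def del: list_encode.simps)
    ultimately show ?thesis using least by (simp add: kleene_app_def fun_eq_iff)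
  qed
  have "x \<notin> (\<Inter>k. A k)" if "r n \<noteq> 0" for n
  proof -
    from that have "refuted unit_square (A (?c n)) (map q [0..<n])" by (metis r_def)
    with q have "x \<notin> A (?c n)"
      unfolding refuted_def length_map length_upt diff_zero by blast
    then show ?thesis by blast
  qed
  moreover have "\<exists>n. r n \<noteq> 0" if x: "x \<notin> (\<Inter>k. A k)"
  proof (rule ccontr)
    assume "\<nexists>n. r n \<noteq> 0"
    then have "\<not> refuted unit_square (A (?c n)) (map q [0..<n])" for n
      unfolding r_def by (metis one_neq_zero)
    then have "\<exists>q' y. unit_square q' = Some y \<and> map q' [0..<n] = map q [0..<n] \<and> y \<in> A (?c n)" for n
      unfolding refuted_def by (simp del: list_encode.simps)
    then obtain Y y where Y: "\<And>n. unit_square (Y n) = Some (y n)"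
        "\<And>n. map (Y n) [0..<n] = map q [0..<n]" "\<And>n. y n \<in> A (?c n)" by metis
    have "baire_conv Y q"
      unfolding baire_conv_def eventually_sequentially
    proof (intro allI exI impI)
      fix k n assume "Suc k \<le> n"
      with Y(2)[of n] show "Y n k = q k" by simp
    qed
    then have "y \<longlonglongrightarrow> x" using unit_square_continuous q Y(1) by (simp add: always_eventually)
    moreover have "\<forall>\<^sub>F n in sequentially. y n \<in> A N"
      unfolding eventually_sequentially
    proof (intro exI allI impI)
      fix n assume "N \<le> n"
      then have "A (?c n) \<subseteq> A N" using antimonoD[OF assms(1)] le_list_encode_Cons order_trans by metis
      with Y(3) show "y n \<in> A N" by blast
    qed
    ultimately have "x \<in> A N" using assms(2) Lim_in_closed_set by fastforce
    with x assms(4) show False by simp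
  qed
  ultimately show "\<exists>r. kleene_app ?p q = Some r \<and> (x \<notin> (\<Inter>k. A k) \<longleftrightarrow> (\<exists>n. r n \<noteq> 0))"
    using r by blast
qed


section \<open>Continuous selections from a reduction\<close>

lemma triangleE:
  assumes "T \<in> triangles"
  shows "closed T" "convex T" "T \<noteq> {}" "T \<subseteq> {0..1} \<times> {0..1}"
proof -
  from assms obtain a b c where T: "T = convex hull {a, b, c}" "{a, b, c} \<subseteq> {0..1} \<times> {0..1}"
    unfolding triangles_def by blast
  show "closed T" unfolding T by (intro compact_imp_closed finite_imp_compact_convex_hull) simp
  show "convex T" "T \<noteq> {}" by (simp_all add: T)
  show "T \<subseteq> {0..1} \<times> {0..1}" unfolding T
    by (rule hull_minimal) (use T(2) in \<open>auto intro: convex_Times\<close>)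
qed

text \<open>A play against the reduction: the input triangle shrinks while its name is written. An
  antimonotone sequence that attains its intersection is eventually constant, so the final set is
  again a triangle.\<close>

definition strategy :: "(nat \<Rightarrow> (real \<times> real) set) \<Rightarrow> bool" where
  "strategy A \<longleftrightarrow> antimono A \<and> range A \<subseteq> triangles \<and> (\<exists>N. A N = (\<Inter>k. A k))"

lemma strategy_Inter:
  assumes "strategy A"
  shows "(\<Inter>k. A k) \<in> triangles"
  using assms unfolding strategy_def by (metis rangeI subsetD)

text \<open>What is left of a reduction: for each play a rectangle, the queried pair of intervals,
  and a continuous choice from the final triangle. Rectangles are only upper semicontinuous in the
  play: limits of their points land in the limit rectangle, which may be larger than the limit of
  the rectangles.\<close>

locale rectangle_choice =
  fixes lo hi :: "(nat \<Rightarrow> (real \<times> real) set) \<Rightarrow> real \<times> real"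
    and F :: "(nat \<Rightarrow> (real \<times> real) set) \<Rightarrow> real \<times> real \<Rightarrow> real \<times> real"
  assumes box_nonempty: "strategy A \<Longrightarrow> cbox (lo A) (hi A) \<noteq> {}"
    and box_unit: "strategy A \<Longrightarrow> cbox (lo A) (hi A) \<subseteq> cbox (0, 0) (1, 1)"
    and F_in: "strategy A \<Longrightarrow> x \<in> cbox (lo A) (hi A) \<Longrightarrow> F A x \<in> (\<Inter>k. A k)"
    and box_limit: "(\<And>n. strategy (B n)) \<Longrightarrow> strategy A \<Longrightarrow>
      (\<And>k. \<forall>\<^sub>F n in sequentially. B n k = A k) \<Longrightarrow>
      (\<And>n. X n \<in> cbox (lo (B n)) (hi (B n))) \<Longrightarrow> X \<longlonglongrightarrow> x \<Longrightarrow> x \<in> cbox (lo A) (hi A)"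
    and F_limit: "(\<And>n. strategy (B n)) \<Longrightarrow> strategy A \<Longrightarrow>
      (\<And>k. \<forall>\<^sub>F n in sequentially. B n k = A k) \<Longrightarrow>
      (\<And>n. X n \<in> cbox (lo (B n)) (hi (B n))) \<Longrightarrow> X \<longlonglongrightarrow> x \<Longrightarrow>
      (\<lambda>n. F (B n) (X n)) \<longlonglongrightarrow> F A x"

text \<open>Quantifying over all realizers gives pointwise control. One realizer shows that
  \<open>H p\<close> names an instance \<open>u\<close>; redefining it at the single input
  \<open>h\<close> to any name \<open>r\<close> of any solution leaves a realizer, so
  \<open>K\<close> must cope with every such \<open>r\<close>.\<close>

lemma reduction_answers:
  assumes red: "\<And>G. G \<turnstile> g \<Longrightarrow>
      (\<lambda>p. Option.bind (H p) (\<lambda>h. Option.bind (G h) (\<lambda>r. K (baire_pair p r)))) \<turnstile> f"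
    and named: "\<And>u. u \<in> problem_dom g \<Longrightarrow> solutions g u \<subseteq> ran (target g)"
    and p: "source f p = Some x" "x \<in> problem_dom f"
  obtains h u where "H p = Some h" "source g h = Some u" "u \<in> problem_dom g"
    "\<And>r y. target g r = Some y \<Longrightarrow> y \<in> solutions g u \<Longrightarrow>
       \<exists>q z. K (baire_pair p r) = Some q \<and> target f q = Some z \<and> z \<in> solutions f x"
proof -
  have "\<exists>r y. target g r = Some y \<and> y \<in> solutions g u" if "u \<in> problem_dom g" for u
  proof -
    from that obtain y where "y \<in> solutions g u" by (auto simp: problem_dom_def)
    with named[OF that] show ?thesis by (fastforce simp: ran_def)
  qed
  then obtain s where s: "\<And>u. u \<in> problem_dom g \<Longrightarrow> \<exists>y. target g (s u) = Some y \<and> y \<in> solutions g u"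
    by metis
  \<comment> \<open>Undefined wherever nothing is required, so that definedness of the composition
    forces \<open>h\<close> to name an instance in the domain.\<close>
  define G where "G q = (case source g q of None \<Rightarrow> None
      | Some u \<Rightarrow> if u \<in> problem_dom g then Some (s u) else None)" for q
  have G: "G \<turnstile> g" unfolding realizes_def by (auto simp: G_def s)
  from red[OF G] p obtain q where "Option.bind (H p) (\<lambda>h. Option.bind (G h) (\<lambda>r. K (baire_pair p r))) = Some q"
    unfolding realizes_def by blast
  then obtain h r where h: "H p = Some h" and "G h = Some r"
    by (auto simp: bind_eq_Some_conv)
  then obtain u where u: "source g h = Some u" "u \<in> problem_dom g"
    by (auto simp: G_def split: option.splits if_splits)
  have "\<exists>q z. K (baire_pair p r) = Some q \<and> target f q = Some z \<and> z \<in> solutions f x"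
    if "target g r = Some y" "y \<in> solutions g u" for r y
  proof -
    have "G(h := Some r) \<turnstile> g" using G u that unfolding realizes_def by auto
    from red[OF this] p obtain q z where
      "Option.bind (H p) (\<lambda>h'. Option.bind ((G(h := Some r)) h') (\<lambda>r. K (baire_pair p r))) = Some q"
      "target f q = Some z" "z \<in> solutions f x"
      unfolding realizes_def by blast
    with h show ?thesis by auto
  qed
  with h u that show thesis by blast
qed

text \<open>Otherwise a hyperplane strictly separates the mean from \<open>C\<close>. Integrating
  its inequality over the unit interval, which has mass 1, puts the mean on the side of
  \<open>C\<close>.\<close>

lemma convex_integral_unit_interval:
  fixes g :: "real \<Rightarrow> 'a::euclidean_space"
  assumes C: "convex C" "closed C" and g: "\<And>t. t \<in> {0..1} \<Longrightarrow> g t \<in> C"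
    and int: "integrable lborel (\<lambda>t. indicator {0..1} t *\<^sub>R g t)"
  shows "(LINT t|lborel. indicator {0..1} t *\<^sub>R g t) \<in> C" (is "?I \<in> C")
proof (rule ccontr)
  assume "?I \<notin> C"
  then obtain a b where ab: "a \<bullet> ?I < b" "\<And>x. x \<in> C \<Longrightarrow> b < a \<bullet> x"
    using separating_hyperplane_closed_point[OF C] by blast
  have "b = (LINT t|lborel. indicator {0..1::real} t *\<^sub>R b)" by simp
  also have "\<dots> \<le> (LINT t|lborel. a \<bullet> (indicator {0..1} t *\<^sub>R g t))"
  proof (rule integral_mono)
    show "integrable lborel (\<lambda>t. indicator {0..1::real} t *\<^sub>R b)" by simp
    show "integrable lborel (\<lambda>t. a \<bullet> (indicator {0..1} t *\<^sub>R g t))" using int by (rule integrable_inner_right)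
    show "indicator {0..1} t *\<^sub>R b \<le> a \<bullet> (indicator {0..1} t *\<^sub>R g t)" for t
      using ab(2)[OF g] by (auto simp: indicator_def less_imp_le)
  qed
  also have "\<dots> = a \<bullet> ?I" by (rule integral_inner_right) (use int in simp)
  finally show False using ab(1) by simp
qed

section \<open>From a reduction to a rectangle choice\<close>

locale triangle_reduction =
  fixes H K :: "baire \<rightharpoonup> baire"
  assumes computable_H: "computable H" and computable_K: "computable K"
    and reduces: "\<And>G. G \<turnstile> XC\<^sub>1 \<times>\<^sub>W XC\<^sub>1 \<Longrightarrow>
      (\<lambda>p. Option.bind (H p) (\<lambda>h. Option.bind (G h) (\<lambda>r. K (baire_pair p r))))
        \<turnstile> problem_restrict XC\<^sub>2 triangles"
begin

text \<open>Here and in the next four definitions \<open>the\<close> is meaningful for strategies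
  and, for outcomes, at points of the rectangle and shifts in the unit interval; see
  \<open>reduction_at\<close> and \<open>outcome\<close>.\<close>

definition query :: "(nat \<Rightarrow> (real \<times> real) set) \<Rightarrow> baire" where
  "query A = the (H (shrinking_name unit_square A))"

definition factor\<^sub>1 :: "(nat \<Rightarrow> (real \<times> real) set) \<Rightarrow> real set" where
  "factor\<^sub>1 A = the (closed_rep unit_interval (baire_fst (query A)))"

definition factor\<^sub>2 :: "(nat \<Rightarrow> (real \<times> real) set) \<Rightarrow> real set" where
  "factor\<^sub>2 A = the (closed_rep unit_interval (baire_snd (query A)))"

definition outcome_name :: "(nat \<Rightarrow> (real \<times> real) set) \<Rightarrow> real \<Rightarrow> real \<times> real \<Rightarrow> baire" where
  "outcome_name A t x = the (K (baire_pair (shrinking_name unit_square A)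
     (baire_pair (shifted_name t (fst x)) (shifted_name t (snd x)))))"

definition outcome :: "(nat \<Rightarrow> (real \<times> real) set) \<Rightarrow> real \<Rightarrow> real \<times> real \<Rightarrow> real \<times> real" where
  "outcome A t x = the (unit_square (outcome_name A t x))"

text \<open>The shrinking name is a legal input, so \<open>reduction_answers\<close> applies. The
  instance it yields is the pair of factors because a name names only one instance.\<close>

lemma reduction_at:
  assumes A: "strategy A"
  shows "H (shrinking_name unit_square A) = Some (query A)"
    and "closed_rep unit_interval (baire_fst (query A)) = Some (factor\<^sub>1 A)"
    and "closed_rep unit_interval (baire_snd (query A)) = Some (factor\<^sub>2 A)"
    and "factor\<^sub>1 A \<noteq> {}" "factor\<^sub>2 A \<noteq> {}" "convex (factor\<^sub>1 A)" "convex (factor\<^sub>2 A)"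
    and "\<And>q r y z. unit_interval q = Some y \<Longrightarrow> unit_interval r = Some z \<Longrightarrow>
      y \<in> factor\<^sub>1 A \<Longrightarrow> z \<in> factor\<^sub>2 A \<Longrightarrow>
      \<exists>w v. K (baire_pair (shrinking_name unit_square A) (baire_pair q r)) = Some w \<and>
        unit_square w = Some v \<and> v \<in> (\<Inter>k. A k)"
proof -
  let ?p = "shrinking_name unit_square A" and ?f = "problem_restrict XC\<^sub>2 triangles"
  have tri: "A k \<in> triangles" for k using A unfolding strategy_def by blast
  from A obtain N where N: "A N = (\<Inter>k. A k)" "antimono A" unfolding strategy_def by blast
  have T: "(\<Inter>k. A k) \<in> triangles" using A by (rule strategy_Inter)
  have rep: "closed_rep unit_square ?p = Some (\<Inter>k. A k)"
    by (rule closed_rep_shrinking_name[OF N(2) _ _ N(1)]) (use triangleE tri in blast)+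
  have source: "source ?f ?p = Some (\<Inter>k. A k)"
    using rep by (simp add: problem_restrict_def convex_choice_def closed_choice_def)
  have sol: "solutions ?f (\<Inter>k. A k) = (\<Inter>k. A k)"
    using T triangleE(2)[OF T] by (simp add: problem_restrict_def convex_choice_def closed_choice_def)
  have dom: "(\<Inter>k. A k) \<in> problem_dom ?f"
    using source triangleE(3)[OF T] unfolding problem_dom_def ran_def by (simp add: sol) blast
  have sol1: "solutions XC\<^sub>1 U = (if convex U then U else {})" for U
    by (simp add: problem_restrict_def convex_choice_def closed_choice_def)
  have parts: "source XC\<^sub>1 = closed_rep unit_interval" "target XC\<^sub>1 = unit_interval" "target ?f = unit_square"
    by (simp_all add: problem_restrict_def convex_choice_def closed_choice_def)
  have named: "solutions (XC\<^sub>1 \<times>\<^sub>W XC\<^sub>1) u \<subseteq> ran (target (XC\<^sub>1 \<times>\<^sub>W XC\<^sub>1))"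
    if "u \<in> problem_dom (XC\<^sub>1 \<times>\<^sub>W XC\<^sub>1)" for u
  proof -
    obtain U V where u: "u = (U, V)" by fastforce
    with that have "U \<in> ran (closed_rep unit_interval)" "V \<in> ran (closed_rep unit_interval)"
      by (auto simp: problem_dom_def problem_prod_def ran_prod_rep parts)
    then have "U \<subseteq> ran unit_interval" "V \<subseteq> ran unit_interval"
      using closed_rep_subset by (fastforce simp: ran_def)+
    then show ?thesis by (auto simp: u problem_prod_def ran_prod_rep parts sol1 split: if_splits)
  qed
  from reduction_answers[OF reduces named source dom] obtain h u where hu:
      "H ?p = Some h" "source (XC\<^sub>1 \<times>\<^sub>W XC\<^sub>1) h = Some u" "u \<in> problem_dom (XC\<^sub>1 \<times>\<^sub>W XC\<^sub>1)"
      "\<And>r y. target (XC\<^sub>1 \<times>\<^sub>W XC\<^sub>1) r = Some y \<Longrightarrow> y \<in> solutions (XC\<^sub>1 \<times>\<^sub>W XC\<^sub>1) u \<Longrightarrow>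
       \<exists>q z. K (baire_pair ?p r) = Some q \<and> target ?f q = Some z \<and> z \<in> solutions ?f (\<Inter>k. A k)"
    by metis
  obtain U V where u: "u = (U, V)" by fastforce
  show h: "H ?p = Some (query A)" using hu(1) by (simp add: query_def)
  with hu(1) have hq: "h = query A" by simp
  from hu(2) show U: "closed_rep unit_interval (baire_fst (query A)) = Some (factor\<^sub>1 A)"
    and V: "closed_rep unit_interval (baire_snd (query A)) = Some (factor\<^sub>2 A)"
    unfolding hq u factor\<^sub>1_def factor\<^sub>2_def
    by (auto simp: problem_prod_def prod_rep_def parts bind_eq_Some_conv)
  from hu(2) U V have UV: "U = factor\<^sub>1 A" "V = factor\<^sub>2 A"
    unfolding hq u by (auto simp: problem_prod_def prod_rep_def parts bind_eq_Some_conv)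
  from hu(3) show "factor\<^sub>1 A \<noteq> {}" "factor\<^sub>2 A \<noteq> {}"
    and convex: "convex (factor\<^sub>1 A)" "convex (factor\<^sub>2 A)"
    by (auto simp: u UV problem_dom_def problem_prod_def sol1 split: if_splits)
  show "\<exists>w v. K (baire_pair ?p (baire_pair q r)) = Some w \<and> unit_square w = Some v \<and> v \<in> (\<Inter>k. A k)"
    if "unit_interval q = Some y" "unit_interval r = Some z" "y \<in> factor\<^sub>1 A" "z \<in> factor\<^sub>2 A" for q r y z
  proof -
    have "target (XC\<^sub>1 \<times>\<^sub>W XC\<^sub>1) (baire_pair q r) = Some (y, z)"
      using that by (simp add: problem_prod_def prod_rep_def parts)
    moreover have "(y, z) \<in> solutions (XC\<^sub>1 \<times>\<^sub>W XC\<^sub>1) u"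
      using that convex by (simp add: problem_prod_def u UV sol1)
    ultimately show ?thesis using hu(4) unfolding sol parts by blast
  qed
qed

lemma factor_subset:
  assumes "strategy A"
  shows "factor\<^sub>1 A \<subseteq> {0..1}" "factor\<^sub>2 A \<subseteq> {0..1}"
  using reduction_at(2,3)[OF assms] closed_rep_subset ran_unit_interval by blast+

lemma ex_good_shift: "\<exists>t\<in>{0..1}. t \<notin> bad_shifts y"
proof (rule ccontr)
  assume "\<not> (\<exists>t\<in>{0..1}. t \<notin> bad_shifts y)"
  then have "countable {0..1::real}" using countable_bad_shifts by (meson countable_subset subsetI)
  then show False using uncountable_closed_interval[of 0 "1::real"] by simp
qed

lemma query_conv:
  assumes "\<And>n. strategy (B n)" "strategy A" "\<And>k. \<forall>\<^sub>F n in sequentially. B n k = A k"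
  shows "baire_conv (\<lambda>n. query (B n)) (query A)"
proof (rule computable_continuous[OF computable_H shrinking_name_conv])
  show "H (shrinking_name unit_square A) = Some (query A)" using assms(2) by (rule reduction_at)
  show "\<forall>\<^sub>F n in sequentially. H (shrinking_name unit_square (B n)) = Some (query (B n))"
    using reduction_at(1)[OF assms(1)] by simp
qed (rule assms(3))

lemma unit_interval_shifted_name:
  "t \<in> {0..1} \<Longrightarrow> x \<in> {0..1} \<Longrightarrow> unit_interval (shifted_name t x) = Some x"
  by (simp add: unit_interval_eq_Some_iff cauchy_name_shifted_name)

text \<open>Upper semicontinuity of the queried intervals: the queries converge with the plays,
  \<open>H\<close> being continuous, and \<open>closed_rep_limit\<close> carries this over to the
  sets.\<close>

lemma factor_limit:
  assumes "\<And>n. strategy (B n)" "strategy A" "\<And>k. \<forall>\<^sub>F n in sequentially. B n k = A k"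
    and "X \<longlonglongrightarrow> x"
  shows "(\<And>n. X n \<in> factor\<^sub>1 (B n)) \<Longrightarrow> x \<in> factor\<^sub>1 A"
    and "(\<And>n. X n \<in> factor\<^sub>2 (B n)) \<Longrightarrow> x \<in> factor\<^sub>2 A"
proof -
  \<comment> \<open>A shift that is good at \<open>x\<close> makes the names of the
    \<open>X n\<close> converge to a name of \<open>x\<close>.\<close>
  obtain t where t: "t \<in> {0..1}" "t \<notin> bad_shifts x" using ex_good_shift by blast
  have names: "baire_conv (\<lambda>n. shifted_name t (X n)) (shifted_name t x)"
    by (rule shifted_name_conv[OF assms(4) tendsto_const t(2)])
  show "x \<in> factor\<^sub>1 A" if X: "\<And>n. X n \<in> factor\<^sub>1 (B n)"
  proof (rule closed_rep_limit[OF baire_conv_fst[OF query_conv[OF assms(1-3)]] names])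
    have unit: "X n \<in> {0..1}" for n using X factor_subset(1)[OF assms(1)] by blast
    then have "x \<in> {0..1}" by (intro Lim_in_closed_set[OF closed_atLeastAtMost _ _ assms(4)]) simp_all
    with t(1) unit show "unit_interval (shifted_name t x) = Some x" "\<And>n. unit_interval (shifted_name t (X n)) = Some (X n)"
      by (simp_all add: unit_interval_shifted_name)
  qed (use X reduction_at(2) assms in auto)
  show "x \<in> factor\<^sub>2 A" if X: "\<And>n. X n \<in> factor\<^sub>2 (B n)"
  proof (rule closed_rep_limit[OF baire_conv_snd[OF query_conv[OF assms(1-3)]] names])
    have unit: "X n \<in> {0..1}" for n using X factor_subset(2)[OF assms(1)] by blast
    then have "x \<in> {0..1}" by (intro Lim_in_closed_set[OF closed_atLeastAtMost _ _ assms(4)]) simp_all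
    with t(1) unit show "unit_interval (shifted_name t x) = Some x" "\<And>n. unit_interval (shifted_name t (X n)) = Some (X n)"
      by (simp_all add: unit_interval_shifted_name)
  qed (use X reduction_at(3) assms in auto)
qed

section \<open>The queried rectangle and the answers on it\<close>

definition lower :: "(nat \<Rightarrow> (real \<times> real) set) \<Rightarrow> real \<times> real" where
  "lower A = (Inf (factor\<^sub>1 A), Inf (factor\<^sub>2 A))"

definition upper :: "(nat \<Rightarrow> (real \<times> real) set) \<Rightarrow> real \<times> real" where
  "upper A = (Sup (factor\<^sub>1 A), Sup (factor\<^sub>2 A))"

lemma closed_convex_unit_interval:
  fixes S :: "real set"
  assumes "convex S" "closed S" "S \<subseteq> {0..1}" "S \<noteq> {}"
  shows "S = {Inf S..Sup S}"
proof -
  have "compact S"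
    using assms(2,3) by (metis bounded_closed_interval bounded_subset compact_eq_bounded_closed)
  moreover have "connected S" using assms(1) by (rule convex_connected)
  ultimately have "\<exists>a b. S = {a..b}" unfolding connected_compact_interval_1[symmetric] by simp
  then obtain a b where S: "S = {a..b}" by (elim exE)
  with assms(4) have "a \<le> b" by simp
  with S show ?thesis by simp
qed

lemma box_eq:
  assumes A: "strategy A"
  shows "cbox (lower A) (upper A) = factor\<^sub>1 A \<times> factor\<^sub>2 A"
proof -
  \<comment> \<open>Closedness is \<open>factor_limit\<close> for a constant sequence of
    plays.\<close>
  have "closed (factor\<^sub>1 A)"
    unfolding closed_sequential_limits
  proof (intro allI impI, elim conjE)
    fix X x assume "\<forall>n. X n \<in> factor\<^sub>1 A" "X \<longlonglongrightarrow> x"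
    then show "x \<in> factor\<^sub>1 A" using factor_limit(1)[of "\<lambda>_. A" A X x] A by simp
  qed
  from closed_convex_unit_interval[OF reduction_at(6)[OF A] this factor_subset(1)[OF A] reduction_at(4)[OF A]]
  have 1: "factor\<^sub>1 A = {Inf (factor\<^sub>1 A)..Sup (factor\<^sub>1 A)}" .
  have "closed (factor\<^sub>2 A)"
    unfolding closed_sequential_limits
  proof (intro allI impI, elim conjE)
    fix X x assume "\<forall>n. X n \<in> factor\<^sub>2 A" "X \<longlonglongrightarrow> x"
    then show "x \<in> factor\<^sub>2 A" using factor_limit(2)[of "\<lambda>_. A" A X x] A by simp
  qed
  from closed_convex_unit_interval[OF reduction_at(7)[OF A] this factor_subset(2)[OF A] reduction_at(5)[OF A]]
  have 2: "factor\<^sub>2 A = {Inf (factor\<^sub>2 A)..Sup (factor\<^sub>2 A)}" .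
  show ?thesis unfolding lower_def upper_def cbox_Pair_eq cbox_interval[where 'a = real]
      1[symmetric] 2[symmetric] by (rule refl)
qed

lemma outcome:
  assumes A: "strategy A" and x: "x \<in> cbox (lower A) (upper A)" and t: "t \<in> {0..1}"
  shows "K (baire_pair (shrinking_name unit_square A)
      (baire_pair (shifted_name t (fst x)) (shifted_name t (snd x)))) = Some (outcome_name A t x)"
    and "unit_square (outcome_name A t x) = Some (outcome A t x)"
    and "outcome A t x \<in> (\<Inter>k. A k)"
proof -
  have "fst x \<in> factor\<^sub>1 A" "snd x \<in> factor\<^sub>2 A" using x by (auto simp: box_eq[OF A])
  moreover from this have "fst x \<in> {0..1}" "snd x \<in> {0..1}" using factor_subset[OF A] by blast+
  ultimately obtain w v where w: "K (baire_pair (shrinking_name unit_square A)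
      (baire_pair (shifted_name t (fst x)) (shifted_name t (snd x)))) = Some w"
      "unit_square w = Some v" "v \<in> (\<Inter>k. A k)"
    using reduction_at(8)[OF A unit_interval_shifted_name[OF t] unit_interval_shifted_name[OF t]] by blast
  then show "K (baire_pair (shrinking_name unit_square A)
      (baire_pair (shifted_name t (fst x)) (shifted_name t (snd x)))) = Some (outcome_name A t x)"
    "unit_square (outcome_name A t x) = Some (outcome A t x)" "outcome A t x \<in> (\<Inter>k. A k)"
    by (simp_all add: outcome_def outcome_name_def)
qed

text \<open>For a good shift the inputs of \<open>K\<close> converge, hence so do its answers. A
  varying shift gives the continuity in \<open>t\<close> behind measurability; a constant shift
  gives the pointwise limits for dominated convergence.\<close>

lemma outcome_conv:
  assumes "\<And>n. strategy (B n)" "strategy A" "\<And>k. \<forall>\<^sub>F n in sequentially. B n k = A k"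
    and X: "X \<longlonglongrightarrow> x" "\<And>n. X n \<in> cbox (lower (B n)) (upper (B n))" "x \<in> cbox (lower A) (upper A)"
    and s: "s \<longlonglongrightarrow> t" "\<forall>\<^sub>F n in sequentially. s n \<in> {0..1}" "t \<in> {0..1}"
    and t: "t \<notin> bad_shifts (fst x)" "t \<notin> bad_shifts (snd x)"
  shows "(\<lambda>n. outcome (B n) (s n) (X n)) \<longlonglongrightarrow> outcome A t x"
proof -
  define P where "P n = baire_pair (shrinking_name unit_square (B n))
    (baire_pair (shifted_name (s n) (fst (X n))) (shifted_name (s n) (snd (X n))))" for n
  define p where "p = baire_pair (shrinking_name unit_square A)
    (baire_pair (shifted_name t (fst x)) (shifted_name t (snd x)))"
  have inputs: "baire_conv P p"
    unfolding P_def[abs_def] p_def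
    by (rule baire_conv_pair[OF shrinking_name_conv[OF assms(3)] baire_conv_pair[OF
          shifted_name_conv[OF tendsto_fst[OF X(1)] s(1) t(1)]
          shifted_name_conv[OF tendsto_snd[OF X(1)] s(1) t(2)]]])
  have defined: "\<forall>\<^sub>F n in sequentially. K (P n) = Some (outcome_name (B n) (s n) (X n))"
    unfolding P_def using s(2) by (rule eventually_mono) (rule outcome(1)[OF assms(1) X(2)])
  have "K p = Some (outcome_name A t x)"
    unfolding p_def by (rule outcome(1)[OF assms(2) X(3) s(3)])
  from computable_continuous[OF computable_K inputs this defined]
  have names: "baire_conv (\<lambda>n. outcome_name (B n) (s n) (X n)) (outcome_name A t x)" .
  have outcomes: "\<forall>\<^sub>F n in sequentially. unit_square (outcome_name (B n) (s n) (X n)) = Some (outcome (B n) (s n) (X n))"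
    using s(2) by (rule eventually_mono) (rule outcome(2)[OF assms(1) X(2)])
  show ?thesis by (rule unit_square_continuous[OF names outcome(2)[OF assms(2) X(3) s(3)] outcomes])
qed

section \<open>Averaging over the shifts\<close>

abbreviation cut_outcome :: "(nat \<Rightarrow> (real \<times> real) set) \<Rightarrow> real \<times> real \<Rightarrow> real \<Rightarrow> real \<times> real" where
  "cut_outcome A x t \<equiv> indicator {0..1} t *\<^sub>R outcome A t x"

lemma cut_outcome_measurable:
  assumes A: "strategy A" and x: "x \<in> cbox (lower A) (upper A)"
  shows "cut_outcome A x \<in> borel_measurable lborel"
proof -
  \<comment> \<open>The shifts 0 and 1 join the exceptions because the indicator jumps
    there.\<close>
  define Z where "Z = bad_shifts (fst x) \<union> bad_shifts (snd x) \<union> {0, 1}"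
  have "continuous_on (- Z) (cut_outcome A x)"
    unfolding continuous_on_sequentially
  proof (intro allI ballI impI)
    fix s t assume t: "t \<in> - Z" and "(\<forall>n. s n \<in> - Z) \<and> s \<longlonglongrightarrow> t"
    then have s: "s \<longlonglongrightarrow> t" by simp
    show "(cut_outcome A x \<circ> s) \<longlonglongrightarrow> cut_outcome A x t"
    proof (cases "t \<in> {0<..<1}")
      case True
      with s have ev: "\<forall>\<^sub>F n in sequentially. s n \<in> {0..1}"
        by (auto intro: eventually_mono[OF topological_tendstoD[OF s open_greaterThanLessThan True]])
      have "(\<lambda>n. outcome A (s n) x) \<longlonglongrightarrow> outcome A t x"
        by (rule outcome_conv[OF A A _ tendsto_const x x s ev]) (use t True in \<open>auto simp: Z_def\<close>)
      moreover have "\<forall>\<^sub>F n in sequentially. outcome A (s n) x = (cut_outcome A x \<circ> s) n"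
        using ev by eventually_elim simp
      ultimately have "(cut_outcome A x \<circ> s) \<longlonglongrightarrow> outcome A t x" using Lim_transform_eventually by blast
      with True show ?thesis by simp
    next
      case False
      with t have "t \<in> - {0..1}" by (auto simp: Z_def)
      then have "\<forall>\<^sub>F n in sequentially. s n \<in> - {0..1}"
        by (intro topological_tendstoD[OF s]) auto
      then have "\<forall>\<^sub>F n in sequentially. 0 = (cut_outcome A x \<circ> s) n"
        by eventually_elim simp
      from Lim_transform_eventually[OF tendsto_const this] show ?thesis
        using \<open>t \<in> - {0..1}\<close> by (simp add: comp_def)
    qed
  qed
  moreover have "countable Z" by (simp add: Z_def countable_bad_shifts)
  ultimately show ?thesis using borel_measurable_continuous_countable_exceptions by auto
qed

text \<open>
  Averaging over the names of \<open>x\<close> turns the multivalued answer of the reduction into a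
  single-valued one: for each \<open>x\<close>, all but countably many of the names \<open>shifted_name t x\<close> depend
  continuously on \<open>x\<close>, and convexity keeps the mean inside the triangle.
\<close>

definition mean_outcome :: "(nat \<Rightarrow> (real \<times> real) set) \<Rightarrow> real \<times> real \<Rightarrow> real \<times> real" where
  "mean_outcome A x = (LINT t|lborel. cut_outcome A x t)"

text \<open>Supplies the dominating function: 2 bounds the sum of the coordinates on the unit
  square, hence the norm.\<close>

lemma cut_outcome_bound:
  assumes A: "strategy A" and x: "x \<in> cbox (lower A) (upper A)"
  shows "norm (cut_outcome A x t) \<le> indicator {0..1} t *\<^sub>R 2"
proof (cases "t \<in> {0..1}")
  case True
  then have "outcome A t x \<in> {0..1} \<times> {0..1}"
    using outcome(3)[OF A x] triangleE(4)[OF strategy_Inter[OF A]] by blast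
  then have "norm (fst (outcome A t x)) + norm (snd (outcome A t x)) \<le> 2" by (auto simp: mem_Times_iff)
  then have "norm (outcome A t x) \<le> 2" using norm_Pair_le[of "fst (outcome A t x)" "snd (outcome A t x)"] by simp
  with True show ?thesis by simp
qed simp

lemma cut_outcome_integrable:
  assumes A: "strategy A" and x: "x \<in> cbox (lower A) (upper A)"
  shows "integrable lborel (cut_outcome A x)"
proof (rule Bochner_Integration.integrable_bound)
  show "integrable lborel (\<lambda>t. indicator {0..1::real} t *\<^sub>R (2::real))" by simp
  show "AE t in lborel. norm (cut_outcome A x t) \<le> norm (indicator {0..1::real} t *\<^sub>R (2::real))"
    using cut_outcome_bound[OF A x] by (auto intro!: AE_I2 elim: order_trans)
qed (rule cut_outcome_measurable[OF A x])

sublocale rectangle_choice lower upper mean_outcome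
proof
  fix A assume A: "strategy A"
  show "cbox (lower A) (upper A) \<noteq> {}" using reduction_at(4,5)[OF A] by (simp add: box_eq[OF A])
  show "cbox (lower A) (upper A) \<subseteq> cbox (0, 0) (1, 1)"
    unfolding box_eq[OF A] cbox_Pair_eq using factor_subset[OF A] by auto
  show "mean_outcome A x \<in> (\<Inter>k. A k)" if x: "x \<in> cbox (lower A) (upper A)" for x
    unfolding mean_outcome_def
    by (rule convex_integral_unit_interval[OF triangleE(2,1)[OF strategy_Inter[OF A]]
          outcome(3)[OF A x] cut_outcome_integrable[OF A x]])
next
  fix A x and B :: "nat \<Rightarrow> nat \<Rightarrow> (real \<times> real) set" and X :: "nat \<Rightarrow> real \<times> real"
  assume B: "\<And>n. strategy (B n)" and A: "strategy A" and BA: "\<And>k. \<forall>\<^sub>F n in sequentially. B n k = A k"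
    and X: "\<And>n. X n \<in> cbox (lower (B n)) (upper (B n))" and lim: "X \<longlonglongrightarrow> x"
  have "fst (X n) \<in> factor\<^sub>1 (B n)" "snd (X n) \<in> factor\<^sub>2 (B n)" for n
    using X[of n] by (auto simp: box_eq[OF B])
  then have "fst x \<in> factor\<^sub>1 A" "snd x \<in> factor\<^sub>2 A"
    using factor_limit[OF B A BA tendsto_fst[OF lim]] factor_limit[OF B A BA tendsto_snd[OF lim]] by blast+
  then show x: "x \<in> cbox (lower A) (upper A)" by (simp add: box_eq[OF A] mem_Times_iff)
  show "(\<lambda>n. mean_outcome (B n) (X n)) \<longlonglongrightarrow> mean_outcome A x"
    unfolding mean_outcome_def
  proof (rule integral_dominated_convergence)
    show "integrable lborel (\<lambda>t. indicator {0..1::real} t *\<^sub>R (2::real))" by simp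
    show "AE t in lborel. norm (cut_outcome (B n) (X n) t) \<le> indicator {0..1} t *\<^sub>R 2" for n
      using cut_outcome_bound[OF B X] by simp
    \<comment> \<open>For the fixed limit point \<open>x\<close> the exceptional shifts are
      countable, so the answers converge for almost every shift.\<close>
    have "AE t in lborel. t \<notin> bad_shifts (fst x) \<union> bad_shifts (snd x)"
      by (intro AE_not_in countable_imp_null_set_lborel) (simp add: countable_bad_shifts)
    then show "AE t in lborel. (\<lambda>n. cut_outcome (B n) (X n) t) \<longlonglongrightarrow> cut_outcome A x t"
    proof eventually_elim
      case (elim t)
      show ?case
      proof (cases "t \<in> {0..1}")
        case True
        with elim show ?thesis using outcome_conv[OF B A BA lim X x, of "\<lambda>_. t" t] by simp
      qed simp
    qed
  qed (use cut_outcome_measurable A B X x in blast)+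
qed

end


section \<open>Planar boxes\<close>

lemma cbox_limit_mem:
  fixes l u x :: "nat \<Rightarrow> 'a::euclidean_space"
  assumes "l \<longlonglongrightarrow> l'" "u \<longlonglongrightarrow> u'" "x \<longlonglongrightarrow> x'" "\<And>n. x n \<in> cbox (l n) (u n)"
  shows "x' \<in> cbox l' u'"
  unfolding mem_box
proof (intro ballI conjI)
  fix i :: 'a assume i: "i \<in> Basis"
  have lim: "(\<lambda>n. l n \<bullet> i) \<longlonglongrightarrow> l' \<bullet> i" "(\<lambda>n. u n \<bullet> i) \<longlonglongrightarrow> u' \<bullet> i" "(\<lambda>n. x n \<bullet> i) \<longlonglongrightarrow> x' \<bullet> i"
    by (intro tendsto_inner tendsto_const assms)+
  show "l' \<bullet> i \<le> x' \<bullet> i" using LIMSEQ_le[OF lim(1,3)] assms(4) i by (auto simp: mem_box)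
  show "x' \<bullet> i \<le> u' \<bullet> i" using LIMSEQ_le[OF lim(3,2)] assms(4) i by (auto simp: mem_box)
qed

lemma mem_cbox_prod:
  fixes x :: "real \<times> real"
  shows "x \<in> cbox l u \<longleftrightarrow> fst x \<in> {fst l..fst u} \<and> snd x \<in> {snd l..snd u}"
  by (cases x; cases l; cases u) auto

lemma cbox_limit_approx:
  fixes l u :: "nat \<Rightarrow> real \<times> real"
  assumes lim: "l \<longlonglongrightarrow> l'" "u \<longlonglongrightarrow> u'" and ne: "\<And>n. cbox (l n) (u n) \<noteq> {}" and x: "x \<in> cbox l' u'"
  obtains X where "X \<longlonglongrightarrow> x" "\<And>n. X n \<in> cbox (l n) (u n)"
proof
  \<comment> \<open>Clamping \<open>x\<close> into the \<open>n\<close>-th box, coordinate by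
    coordinate, depends continuously on the corners and fixes \<open>x\<close> in the limit.\<close>
  let ?X = "\<lambda>n. (max (fst (l n)) (min (fst (u n)) (fst x)), max (snd (l n)) (min (snd (u n)) (snd x)))"
  have "?X \<longlonglongrightarrow> (max (fst l') (min (fst u') (fst x)), max (snd l') (min (snd u') (snd x)))"
    by (intro tendsto_intros lim)
  also have "(max (fst l') (min (fst u') (fst x)), max (snd l') (min (snd u') (snd x))) = x"
    using x by (auto simp: mem_cbox_prod prod_eq_iff)
  finally show "?X \<longlonglongrightarrow> x" .
  show "?X n \<in> cbox (l n) (u n)" for n
    using ne[of n] by (fastforce simp: mem_cbox_prod)
qed

lemma cbox_corners_mem:
  fixes l u :: "'a::euclidean_space"
  assumes "cbox l u \<noteq> {}"
  shows "l \<in> cbox l u" "u \<in> cbox l u"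
  using assms by (simp_all add: box_ne_empty mem_box)

text \<open>The limit \<open>x'\<close> is away from at least one limit end. If it is below
  \<open>b'\<close>, all late points are below all late upper ends, so the larger of two points lies
  in the interval of the smaller. The other case is symmetric.\<close>

lemma interval_sequences_overlap:
  fixes a b x :: "nat \<Rightarrow> real"
  assumes lim: "a \<longlonglongrightarrow> a'" "b \<longlonglongrightarrow> b'" "x \<longlonglongrightarrow> x'" and x: "\<And>n. x n \<in> {a n..b n}" and "a' < b'"
  shows "\<exists>N. \<forall>n\<ge>N. \<forall>m\<ge>N. x n \<in> {a m..b m} \<or> x m \<in> {a n..b n}"
proof -
  consider "x' < b'" | "a' < x'" using \<open>a' < b'\<close> by linarith
  then show ?thesis
  proof cases
    case 1
    let ?d = "(x' + b') / 2"
    have "\<forall>\<^sub>F n in sequentially. x n < ?d" "\<forall>\<^sub>F n in sequentially. ?d < b n"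
      using order_tendstoD(2)[OF lim(3), of ?d] order_tendstoD(1)[OF lim(2), of ?d] 1 by auto
    then have "\<forall>\<^sub>F n in sequentially. x n < ?d \<and> ?d < b n" by (rule eventually_conj)
    then obtain N where N: "\<And>n. n \<ge> N \<Longrightarrow> x n < ?d \<and> ?d < b n" by (auto simp: eventually_sequentially)
    have "x n \<in> {a m..b m} \<or> x m \<in> {a n..b n}" if "n \<ge> N" "m \<ge> N" for n m
      using N[OF that(1)] N[OF that(2)] x[of n] x[of m] by (auto simp del: add_divide_distrib)
    then show ?thesis by blast
  next
    case 2
    let ?d = "(x' + a') / 2"
    have "\<forall>\<^sub>F n in sequentially. ?d < x n" "\<forall>\<^sub>F n in sequentially. a n < ?d"
      using order_tendstoD(1)[OF lim(3), of ?d] order_tendstoD(2)[OF lim(1), of ?d] 2 by auto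
    then have "\<forall>\<^sub>F n in sequentially. ?d < x n \<and> a n < ?d" by (rule eventually_conj)
    then obtain N where N: "\<And>n. n \<ge> N \<Longrightarrow> ?d < x n \<and> a n < ?d" by (auto simp: eventually_sequentially)
    have "x n \<in> {a m..b m} \<or> x m \<in> {a n..b n}" if "n \<ge> N" "m \<ge> N" for n m
      using N[OF that(1)] N[OF that(2)] x[of n] x[of m] by (auto simp del: add_divide_distrib)
    then show ?thesis by blast
  qed
qed

lemma interval_sequences_interior:
  fixes a b x :: "nat \<Rightarrow> real"
  assumes lim: "a \<longlonglongrightarrow> a'" "b \<longlonglongrightarrow> b'" "x \<longlonglongrightarrow> x'" and "a' < x'" "x' < b'"
  shows "\<exists>N. \<forall>n\<ge>N. \<forall>m\<ge>N. x n \<in> {a m..b m}"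
proof -
  let ?c = "(x' + a') / 2" and ?d = "(x' + b') / 2"
  have "\<forall>\<^sub>F n in sequentially. (?c < x n \<and> x n < ?d) \<and> a n < ?c \<and> ?d < b n"
    using assms(4,5) order_tendstoD(1)[OF lim(3), of ?c] order_tendstoD(2)[OF lim(1), of ?c]
      order_tendstoD(2)[OF lim(3), of ?d] order_tendstoD(1)[OF lim(2), of ?d]
    by (intro eventually_conj) auto
  then obtain N where N: "\<And>n. n \<ge> N \<Longrightarrow> (?c < x n \<and> x n < ?d) \<and> a n < ?c \<and> ?d < b n"
    by (auto simp: eventually_sequentially)
  have "x n \<in> {a m..b m}" if "n \<ge> N" "m \<ge> N" for n m
    using N[OF that(1)] N[OF that(2)] by (auto simp del: add_divide_distrib)
  then show ?thesis by blast
qed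

text \<open>
  At a corner this can fail: the boxes may grow in one direction while they shrink in the other.
\<close>

lemma box_sequences_overlap:
  fixes l u z :: "nat \<Rightarrow> real \<times> real"
  assumes lim: "l \<longlonglongrightarrow> l'" "u \<longlonglongrightarrow> u'" "z \<longlonglongrightarrow> z'" and z: "\<And>n. z n \<in> cbox (l n) (u n)"
    and proper: "fst l' < fst u'" "snd l' < snd u'"
    and no_corner: "fst z' \<notin> {fst l', fst u'} \<or> snd z' \<notin> {snd l', snd u'}"
  shows "\<exists>N. \<forall>n\<ge>N. \<forall>m\<ge>N. z n \<in> cbox (l m) (u m) \<or> z m \<in> cbox (l n) (u n)"
proof -
  have z': "z' \<in> cbox l' u'" by (rule cbox_limit_mem[OF lim z])
  have fst: "(\<lambda>n. fst (l n)) \<longlonglongrightarrow> fst l'" "(\<lambda>n. fst (u n)) \<longlonglongrightarrow> fst u'" "(\<lambda>n. fst (z n)) \<longlonglongrightarrow> fst z'"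
    "\<And>n. fst (z n) \<in> {fst (l n)..fst (u n)}"
    using lim[THEN tendsto_fst] z by (auto simp: mem_cbox_prod)
  have snd: "(\<lambda>n. snd (l n)) \<longlonglongrightarrow> snd l'" "(\<lambda>n. snd (u n)) \<longlonglongrightarrow> snd u'" "(\<lambda>n. snd (z n)) \<longlonglongrightarrow> snd z'"
    "\<And>n. snd (z n) \<in> {snd (l n)..snd (u n)}"
    using lim[THEN tendsto_snd] z by (auto simp: mem_cbox_prod)
  from interval_sequences_overlap[OF fst proper(1)] obtain N1 where N1:
    "\<forall>n\<ge>N1. \<forall>m\<ge>N1. fst (z n) \<in> {fst (l m)..fst (u m)} \<or> fst (z m) \<in> {fst (l n)..fst (u n)}" by blast
  from interval_sequences_overlap[OF snd proper(2)] obtain N2 where N2: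
    "\<forall>n\<ge>N2. \<forall>m\<ge>N2. snd (z n) \<in> {snd (l m)..snd (u m)} \<or> snd (z m) \<in> {snd (l n)..snd (u n)}" by blast
  \<comment> \<open>A coordinate in the interior lies in all late intervals, so the overlap in the
    other coordinate alone decides which point falls into the other box.\<close>
  from no_corner show ?thesis
  proof
    assume "fst z' \<notin> {fst l', fst u'}"
    with z' have "fst l' < fst z'" "fst z' < fst u'" by (auto simp: mem_cbox_prod)
    from interval_sequences_interior[OF fst(1-3) this] obtain N where
      "\<forall>n\<ge>N. \<forall>m\<ge>N. fst (z n) \<in> {fst (l m)..fst (u m)}" by blast
    with N2 show ?thesis unfolding mem_cbox_prod by (intro exI[of _ "max N N2"]) auto
  next
    assume "snd z' \<notin> {snd l', snd u'}"
    with z' have "snd l' < snd z'" "snd z' < snd u'" by (auto simp: mem_cbox_prod)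
    from interval_sequences_interior[OF snd(1-3) this] obtain N where
      "\<forall>n\<ge>N. \<forall>m\<ge>N. snd (z n) \<in> {snd (l m)..snd (u m)}" by blast
    with N1 show ?thesis unfolding mem_cbox_prod by (intro exI[of _ "max N N1"]) auto
  qed
qed

lemma dist_prod_le:
  fixes x y :: "real \<times> real"
  shows "dist x y \<le> \<bar>fst x - fst y\<bar> + \<bar>snd x - snd y\<bar>"
  using sqrt_sum_squares_le_sum_abs[of "fst x - fst y" "snd x - snd y"]
  by (simp add: dist_prod_def dist_real_def)

text \<open>Pigeonhole: infinitely many indices, but finitely many pairs of a grid cell and a label.
  Points in one cell of side \<open>1 / N\<close> are less than \<open>2 / N\<close> apart.\<close>

lemma close_pair:
  fixes g :: "nat \<Rightarrow> real \<times> real" and \<tau> :: "nat \<Rightarrow> 'b"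
  assumes g: "\<And>n. g n \<in> cbox (0, 0) (1, 1)" and fin: "finite (range \<tau>)" and "\<delta> > 0"
  obtains i j where "i \<noteq> j" "\<tau> i = \<tau> j" "dist (g i) (g j) < \<delta>"
proof -
  obtain N :: nat where N: "2 / \<delta> < real N" using reals_Archimedean2 by blast
  then have "N > 0" using \<open>\<delta> > 0\<close> by (auto intro: Nat.gr0I simp: field_simps)
  with N \<open>\<delta> > 0\<close> have N': "2 / real N < \<delta>" by (simp add: field_simps)
  define h where "h n = (\<lfloor>real N * fst (g n)\<rfloor>, \<lfloor>real N * snd (g n)\<rfloor>, \<tau> n)" for n
  have "\<lfloor>real N * c\<rfloor> \<in> {0..int N}" if "c \<in> {0..1}" for c
    using that by (auto simp: floor_le_iff mult_left_le intro: le_less_trans[of _ "real N"])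
  then have "range h \<subseteq> {0..int N} \<times> {0..int N} \<times> range \<tau>"
    using g by (auto simp: h_def mem_cbox_prod)
  then have "finite (range h)" by (rule finite_subset) (intro finite_cartesian_product fin finite_atLeastAtMost_int)
  then have "\<not> inj h" using finite_imageD by blast
  then obtain i j where ij: "h i = h j" "i \<noteq> j" by (auto simp: inj_def)
  have close: "\<bar>c - d\<bar> < 1 / real N" if "\<lfloor>real N * c\<rfloor> = \<lfloor>real N * d\<rfloor>" for c d
  proof -
    from that have "\<bar>real N * c - real N * d\<bar> < 1" by linarith
    then have "real N * \<bar>c - d\<bar> < 1" by (simp add: abs_mult flip: right_diff_distrib)
    with \<open>N > 0\<close> show ?thesis by (simp add: field_simps)
  qed
  from ij(1) close have "\<bar>fst (g i) - fst (g j)\<bar> < 1 / real N" "\<bar>snd (g i) - snd (g j)\<bar> < 1 / real N"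
    by (auto simp: h_def)
  with dist_prod_le[of "g i" "g j"] N' have "dist (g i) (g j) < \<delta>" by simp
  with ij that show thesis by (auto simp: h_def)
qed


section \<open>Boxes that trace a pencil of segments\<close>

text \<open>Infinitely many distinct numbers in the half-open interval from 0 to 1/2, hence at
  distance at least 1/2 from 1, the first coordinate of every apex.\<close>

abbreviation foot :: "nat \<Rightarrow> real" where
  "foot i \<equiv> 1 / (real i + 2)"

text \<open>The last conjunct is the equation of the line through \<open>(foot i, 0)\<close> and
  \<open>(1, s)\<close>, a form that survives limits in \<open>s\<close> as well. For
  \<open>s\<close> nonzero, the lines for different \<open>i\<close> meet only at
  \<open>(1, s)\<close>.\<close>

definition traces_pencil :: "(real \<times> real \<Rightarrow> real \<times> real) \<Rightarrow> real \<Rightarrow> real \<times> real \<Rightarrow> real \<times> real \<Rightarrow>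
    (nat \<Rightarrow> real \<times> real) \<Rightarrow> (nat \<Rightarrow> real \<times> real) \<Rightarrow> (nat \<Rightarrow> real \<times> real) \<Rightarrow> (nat \<Rightarrow> real \<times> real) \<Rightarrow> bool" where
  "traces_pencil f s l u a b z q \<longleftrightarrow> (\<forall>i. cbox (a i) (b i) \<subseteq> cbox l u \<and>
     z i \<in> cbox (a i) (b i) \<and> f (z i) = (1, s) \<and> q i \<in> cbox (a i) (b i) \<and> f (q i) = (foot i, 0) \<and>
     (\<forall>x\<in>cbox (a i) (b i). (fst (f x) - foot i) * s = snd (f x) * (1 - foot i)))"

text \<open>Both intervals extend by at least \<delta> from their points \<open>x\<close> and
  \<open>x'\<close> in the same direction, while the points are closer than that.\<close>

lemma interval_overlap_same_side:
  fixes c c' x x' :: real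
  assumes "c \<in> {a..b}" "x \<in> {a..b}" "c' \<in> {a'..b'}" "x' \<in> {a'..b'}"
    and "\<delta> \<le> \<bar>c - x\<bar>" "\<delta> \<le> \<bar>c' - x'\<bar>" "\<bar>x - x'\<bar> < \<delta>" "c \<le> x \<longleftrightarrow> c' \<le> x'"
  shows "x \<in> {a'..b'} \<or> x' \<in> {a..b}"
proof (cases "c \<le> x")
  case True
  then have "\<delta> \<le> x - c" "\<delta> \<le> x' - c'" using assms(5,6,8) by auto
  with assms(1-4,7) show ?thesis by (cases "x \<le> x'") auto
next
  case False
  then have "\<delta> \<le> c - x" "\<delta> \<le> c' - x'" using assms(5,6,8) by auto
  with assms(1-4,7) show ?thesis by (cases "x \<le> x'") auto
qed

text \<open>Each interval contains everything between \<open>c\<close> and its own point. As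
  \<open>c\<close> is an end of \<open>{l..u}\<close>, both points lie on one side of it, and the
  nearer one is covered by both intervals.\<close>

lemma interval_overlap_common_end:
  fixes c x x' :: real
  assumes "c \<in> {a..b}" "x \<in> {a..b}" "c \<in> {a'..b'}" "x' \<in> {a'..b'}"
    and "c \<in> {l, u}" "x \<in> {l..u}" "x' \<in> {l..u}"
  shows "x \<in> {a'..b'} \<or> x' \<in> {a..b}"
  using assms by (cases "x \<le> x'") auto

text \<open>
  Boxes \<open>i\<close> and \<open>j\<close> only meet where \<open>f\<close> takes the value \<open>(1, s)\<close>, hence away from the points
  \<open>q i\<close>, whose values are far from \<open>(1, s)\<close>. If the big box were degenerate, or if all \<open>z i\<close>
  were corners of it, then two of the infinitely many boxes would have to meet near \<open>q i\<close>.
\<close>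

lemma traces_pencil_no_corner:
  fixes f :: "real \<times> real \<Rightarrow> real \<times> real"
  assumes tr: "traces_pencil f s l u a b z q" and "s \<noteq> 0"
    and unit: "cbox l u \<subseteq> cbox (0, 0) (1, 1)" and cont: "continuous_on (cbox l u) f"
  shows "fst l < fst u" "snd l < snd u"
    and "\<exists>i. fst (z i) \<notin> {fst l, fst u} \<or> snd (z i) \<notin> {snd l, snd u}"
proof -
  have sub: "cbox (a i) (b i) \<subseteq> cbox l u" and z: "z i \<in> cbox (a i) (b i)" "f (z i) = (1, s)"
    and q: "q i \<in> cbox (a i) (b i)" "f (q i) = (foot i, 0)"
    and line: "\<And>x. x \<in> cbox (a i) (b i) \<Longrightarrow> (fst (f x) - foot i) * s = snd (f x) * (1 - foot i)" for i
    using tr[unfolded traces_pencil_def, THEN spec, of i] by simp_all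
  have "uniformly_continuous_on (cbox l u) f" using cont compact_cbox by (rule compact_uniformly_continuous)
  then have "\<exists>\<delta>>0. \<forall>x\<in>cbox l u. \<forall>y\<in>cbox l u. dist y x < \<delta> \<longrightarrow> dist (f y) (f x) < 1/2"
    unfolding uniformly_continuous_on_def by - (drule spec[of _ "1/2::real"], simp)
  then obtain \<delta> where \<delta>: "\<delta> > 0" "\<And>x y. x \<in> cbox l u \<Longrightarrow> y \<in> cbox l u \<Longrightarrow> dist y x < \<delta> \<Longrightarrow> dist (f y) (f x) < 1/2"
    by blast
  \<comment> \<open>Here 1/2 is the least gap between 1 and \<open>foot i\<close>, so uniform
    continuity keeps the points of box \<open>i\<close> with value \<open>(1, s)\<close> away from
    \<open>q i\<close>, uniformly in \<open>i\<close>.\<close>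
  have far: "\<delta> \<le> dist m (q i)" if m: "m \<in> cbox (a i) (b i)" "f m = (1, s)" for m i
  proof (rule ccontr)
    assume "\<not> \<delta> \<le> dist m (q i)"
    then have "dist (f m) (f (q i)) < 1/2" using \<delta>(2)[of "q i" m] m(1) q(1) sub by (meson not_le subsetD)
    moreover have "dist (fst (f m)) (fst (f (q i))) \<le> dist (f m) (f (q i))" by (rule dist_fst_le)
    moreover have "foot i \<le> 1/2" by (simp add: field_simps)
    ultimately show False by (simp add: m(2) q(2) dist_real_def)
  qed
  have meet: "f m = (1, s)" if m: "m \<in> cbox (a i) (b i)" "m \<in> cbox (a j) (b j)" "i \<noteq> j" for m i j
  proof -
    from m(3) have ne: "foot i \<noteq> foot j" by (simp add: field_simps)
    \<comment> \<open>Subtracting the two line equations cancels the first coordinate.\<close>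
    have "(foot j - foot i) * s = (foot j - foot i) * snd (f m)"
      using line[OF m(1)] line[OF m(2)] by (simp add: algebra_simps)
    with ne have "snd (f m) = s" by simp
    with line[OF m(1)] \<open>s \<noteq> 0\<close> have "fst (f m) = 1" by simp
    with \<open>snd (f m) = s\<close> show ?thesis by (simp add: prod_eq_iff)
  qed
  have no_overlap: False if "i \<noteq> j" "dist (q i) (q j) < \<delta>"
      and 1: "fst (q i) \<in> {fst (a j)..fst (b j)} \<or> fst (q j) \<in> {fst (a i)..fst (b i)}"
      and 2: "snd (q i) \<in> {snd (a j)..snd (b j)} \<or> snd (q j) \<in> {snd (a i)..snd (b i)}" for i j
  proof -
    \<comment> \<open>A common point of both boxes, assembled coordinatewise from \<open>q i\<close>
      and \<open>q j\<close>, hence no farther from \<open>q i\<close> than \<open>q j\<close>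
      is.\<close>
    define m where "m = (if fst (q i) \<in> {fst (a j)..fst (b j)} then fst (q i) else fst (q j),
                         if snd (q i) \<in> {snd (a j)..snd (b j)} then snd (q i) else snd (q j))"
    have m: "m \<in> cbox (a i) (b i)" "m \<in> cbox (a j) (b j)"
      using 1 2 q(1)[of i] q(1)[of j] by (auto simp: m_def mem_cbox_prod)
    have "dist m (q i) \<le> dist (q j) (q i)"
      unfolding dist_prod_def by (rule real_sqrt_le_mono) (auto simp: m_def intro!: add_mono)
    with that(2) have "dist m (q i) < \<delta>" by (simp add: dist_commute)
    with far[OF m(1) meet[OF m that(1)]] show False by simp
  qed
  have finite: "finite (range P)" for P :: "nat \<Rightarrow> bool" by simp
  have q_unit: "q i \<in> cbox (0, 0) (1, 1)" for i using q(1) sub unit by blast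
  have z1: "fst (z i) \<in> {fst (a i)..fst (b i)}" and z2: "snd (z i) \<in> {snd (a i)..snd (b i)}"
    and q1: "fst (q i) \<in> {fst (a i)..fst (b i)}" and q2: "snd (q i) \<in> {snd (a i)..snd (b i)}" for i
    using z(1)[of i] q(1)[of i] by (auto simp: mem_cbox_prod)
  have lu1: "fst (z i) \<in> {fst l..fst u}" "fst (q i) \<in> {fst l..fst u}"
    and lu2: "snd (z i) \<in> {snd l..snd u}" "snd (q i) \<in> {snd l..snd u}" for i
    using subsetD[OF sub z(1)[of i]] subsetD[OF sub q(1)[of i]] by (auto simp: mem_cbox_prod)
  show "fst l < fst u"
  proof (rule ccontr)
    assume "\<not> fst l < fst u"
    then have eq: "fst (z i) = fst l" "fst (q i) = fst l" for i using lu1[of i] by auto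
    \<comment> \<open>With a constant first coordinate, \<open>z i\<close> and \<open>q i\<close>
      differ by at least \<delta> in the second. The label records on which side of
      \<open>q i\<close> the point \<open>z i\<close> lies.\<close>
    obtain i j where ij: "i \<noteq> j" "(snd (z i) \<le> snd (q i)) = (snd (z j) \<le> snd (q j))" "dist (q i) (q j) < \<delta>"
      using close_pair[of q "\<lambda>i. snd (z i) \<le> snd (q i)", OF q_unit finite \<delta>(1)] by blast
    have d: "\<delta> \<le> \<bar>snd (z k) - snd (q k)\<bar>" for k
      using far[OF z(1)[of k] z(2)] dist_prod_le[of "z k" "q k"] by (simp add: eq)
    have "\<bar>snd (q i) - snd (q j)\<bar> < \<delta>"
      using ij(3) dist_snd_le[of "q i" "q j"] by (simp add: dist_real_def)
    from no_overlap[OF ij(1,3) _ interval_overlap_same_side[OF z2 q2 z2 q2 d d this ij(2)]] show False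
      using q1[of j] by (simp add: eq)
  qed
  show "snd l < snd u"
  proof (rule ccontr)
    assume "\<not> snd l < snd u"
    then have eq: "snd (z i) = snd l" "snd (q i) = snd l" for i using lu2[of i] by auto
    obtain i j where ij: "i \<noteq> j" "(fst (z i) \<le> fst (q i)) = (fst (z j) \<le> fst (q j))" "dist (q i) (q j) < \<delta>"
      using close_pair[of q "\<lambda>i. fst (z i) \<le> fst (q i)", OF q_unit finite \<delta>(1)] by blast
    have d: "\<delta> \<le> \<bar>fst (z k) - fst (q k)\<bar>" for k
      using far[OF z(1)[of k] z(2)] dist_prod_le[of "z k" "q k"] by (simp add: eq)
    have "\<bar>fst (q i) - fst (q j)\<bar> < \<delta>"
      using ij(3) dist_fst_le[of "q i" "q j"] by (simp add: dist_real_def)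
    from no_overlap[OF ij(1,3) interval_overlap_same_side[OF z1 q1 z1 q1 d d this ij(2)]] show False
      using q2[of j] by (simp add: eq)
  qed
  show "\<exists>i. fst (z i) \<notin> {fst l, fst u} \<or> snd (z i) \<notin> {snd l, snd u}"
  proof (rule ccontr)
    assume "\<not> ?thesis"
    then have corner: "fst (z i) \<in> {fst l, fst u}" "snd (z i) \<in> {snd l, snd u}" for i by blast+
    have "range z \<subseteq> {fst l, fst u} \<times> {snd l, snd u}"
      by (rule image_subsetI) (use corner in \<open>simp only: mem_Times_iff simp_thms\<close>)
    then have "finite (range z)" by (rule finite_subset) simp
    \<comment> \<open>With finitely many corners the label can be \<open>z i\<close> itself: boxes
      \<open>i\<close> and \<open>j\<close> then share a corner of the big box, and each reaches
      from there to its own \<open>q\<close>.\<close>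
    from close_pair[of q z, OF q_unit this \<delta>(1)] obtain i j where ij: "i \<noteq> j" "z i = z j" "dist (q i) (q j) < \<delta>" by blast
    have "fst (q i) \<in> {fst (a j)..fst (b j)} \<or> fst (q j) \<in> {fst (a i)..fst (b i)}"
      by (rule interval_overlap_common_end[OF z1 q1 z1[of j, folded ij(2)] q1 corner(1) lu1(2) lu1(2)])
    moreover have "snd (q i) \<in> {snd (a j)..snd (b j)} \<or> snd (q j) \<in> {snd (a i)..snd (b i)}"
      by (rule interval_overlap_common_end[OF z2 q2 z2[of j, folded ij(2)] q2 corner(2) lu2(2) lu2(2)])
    ultimately show False using no_overlap[OF ij(1,3)] by blast
  qed
qed


text \<open>One subsequence has to serve all \<open>i\<close> at once. The six sequences are packed
  into one family, bounded by 12 as each point has norm at most 2, and a diagonal argument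
  applies.\<close>

lemma convergent_boxes:
  fixes l u :: "nat \<Rightarrow> real \<times> real" and a b z q :: "nat \<Rightarrow> nat \<Rightarrow> real \<times> real"
  assumes unit: "\<And>n. l n \<in> cbox (0, 0) (1, 1)" "\<And>n. u n \<in> cbox (0, 0) (1, 1)"
    "\<And>n i. a n i \<in> cbox (0, 0) (1, 1)" "\<And>n i. b n i \<in> cbox (0, 0) (1, 1)"
    "\<And>n i. z n i \<in> cbox (0, 0) (1, 1)" "\<And>n i. q n i \<in> cbox (0, 0) (1, 1)"
  obtains k l' u' a' b' z' q' where "strict_mono (k :: nat \<Rightarrow> nat)"
    "(\<lambda>n. l (k n)) \<longlonglongrightarrow> l'" "(\<lambda>n. u (k n)) \<longlonglongrightarrow> u'"
    "\<And>i. (\<lambda>n. a (k n) i) \<longlonglongrightarrow> a' i" "\<And>i. (\<lambda>n. b (k n) i) \<longlonglongrightarrow> b' i"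
    "\<And>i. (\<lambda>n. z (k n) i) \<longlonglongrightarrow> z' i" "\<And>i. (\<lambda>n. q (k n) i) \<longlonglongrightarrow> q' i"
proof -
  define g where "g n i = ((l n, u n), (a n i, b n i), (z n i, q n i))" for n i
  have two: "norm x \<le> 2" if "x \<in> cbox (0, 0) (1, 1)" for x :: "real \<times> real"
    using that norm_Pair_le[of "fst x" "snd x"] by (simp add: mem_cbox_prod)
  have "norm (g n i) \<le> 12" for n i
  proof -
    have "norm (g n i) \<le> norm (l n, u n) + norm ((a n i, b n i), (z n i, q n i))"
      unfolding g_def by (rule norm_Pair_le)
    also have "\<dots> \<le> (norm (l n) + norm (u n)) + (norm (a n i, b n i) + norm (z n i, q n i))"
      by (intro add_mono norm_Pair_le)
    also have "\<dots> \<le> (norm (l n) + norm (u n)) + ((norm (a n i) + norm (b n i)) + (norm (z n i) + norm (q n i)))"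
      by (intro add_mono norm_Pair_le order_refl)
    also have "\<dots> \<le> (2 + 2) + ((2 + 2) + (2 + 2))"
      by (intro add_mono two unit)
    finally show ?thesis by simp
  qed
  then obtain k where k: "strict_mono (k :: nat \<Rightarrow> nat)" "\<And>i. i \<in> UNIV \<Longrightarrow> \<exists>c. (\<lambda>n. g (k n) i) \<longlonglongrightarrow> c"
    by (rule function_convergent_subsequence[of UNIV g 12, OF countableI_type]) (rule that)
  from k(2)[OF UNIV_I] obtain c where c: "\<And>i. (\<lambda>n. g (k n) i) \<longlonglongrightarrow> c i" by metis
  show thesis
  proof (rule that[OF k(1)])
    show "(\<lambda>n. l (k n)) \<longlonglongrightarrow> fst (fst (c 0))" "(\<lambda>n. u (k n)) \<longlonglongrightarrow> snd (fst (c 0))"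
      using tendsto_fst[OF tendsto_fst[OF c[of 0]]] tendsto_snd[OF tendsto_fst[OF c[of 0]]]
      by (simp_all add: g_def)
    show "(\<lambda>n. a (k n) i) \<longlonglongrightarrow> fst (fst (snd (c i)))" "(\<lambda>n. b (k n) i) \<longlonglongrightarrow> snd (fst (snd (c i)))"
        "(\<lambda>n. z (k n) i) \<longlonglongrightarrow> fst (snd (snd (c i)))" "(\<lambda>n. q (k n) i) \<longlonglongrightarrow> snd (snd (snd (c i)))" for i
      using tendsto_fst[OF tendsto_fst[OF tendsto_snd[OF c[of i]]]] tendsto_snd[OF tendsto_fst[OF tendsto_snd[OF c[of i]]]]
        tendsto_fst[OF tendsto_snd[OF tendsto_snd[OF c[of i]]]] tendsto_snd[OF tendsto_snd[OF tendsto_snd[OF c[of i]]]]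
      by (simp_all add: g_def)
  qed
qed


section \<open>The fans of triangles\<close>

text \<open>Contains \<open>fan s\<close> for all \<open>s\<close> in \<open>{0..1}\<close>, so a
  play that starts here can still move to any of them.\<close>

definition base :: "(real \<times> real) set" where
  "base = convex hull {(0, 0), (1, 0), (1, 1)}"

definition fan :: "real \<Rightarrow> (real \<times> real) set" where
  "fan s = convex hull {(0, 0), (1/2, 0), (1, s)}"

text \<open>A segment as a degenerate triangle: the apex is listed twice.\<close>

definition ray :: "real \<Rightarrow> nat \<Rightarrow> (real \<times> real) set" where
  "ray s i = convex hull {(foot i, 0), (1, s), (1, s)}"

lemma triangleI:
  assumes "a \<in> {0..1} \<times> {0..1}" "b \<in> {0..1} \<times> {0..1}" "c \<in> {0..1} \<times> {0..1}"
  shows "convex hull {a, b, c} \<in> triangles"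
  using assms unfolding triangles_def by blast

lemma singleton_triangle: "a \<in> {0..1} \<times> {0..1} \<Longrightarrow> {a} \<in> triangles"
  using triangleI[of a a a] by simp

lemma foot_unit: "0 \<le> foot i" "foot i \<le> 1 / 2"
  by (simp_all add: field_simps)

lemma fan_subset_base:
  assumes "s \<in> {0..1}"
  shows "fan s \<subseteq> base"
proof -
  have "(1/2, 0) \<in> base"
    unfolding base_def convex_hull_3 mem_Collect_eq
    by (rule exI[of _ "1/2"], rule exI[of _ "1/2"], rule exI[of _ 0]) auto
  moreover have "(1, s) \<in> base"
    unfolding base_def convex_hull_3 mem_Collect_eq
    using assms by - (rule exI[of _ 0], rule exI[of _ "1 - s"], rule exI[of _ s], auto)
  moreover have "(0, 0) \<in> base" unfolding base_def by (rule hull_inc) simp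
  ultimately show ?thesis unfolding fan_def by (intro hull_minimal) (auto simp: base_def)
qed

lemma ray_subset_fan: "ray s i \<subseteq> fan s"
proof -
  have "(d, 0) \<in> fan s" if "0 \<le> d" "d \<le> 1 / 2" for d
    unfolding fan_def convex_hull_3 mem_Collect_eq using that
    by - (rule exI[of _ "1 - 2 * d"], rule exI[of _ "2 * d"], rule exI[of _ 0], auto)
  then have "(foot i, 0) \<in> fan s" using foot_unit by blast
  moreover have "(1, s) \<in> fan s" unfolding fan_def by (rule hull_inc) simp
  ultimately show ?thesis unfolding ray_def by (intro hull_minimal) (auto simp: fan_def)
qed

text \<open>The other two vertices have first coordinate at most 1/2, so a point with first
  coordinate 1 puts all its weight on the apex. Hence no fan contains the apex of another.\<close>

lemma fan_apex:
  assumes "(1, t) \<in> fan s"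
  shows "t = s"
proof -
  from assms obtain x y z where "0 \<le> x" "0 \<le> y" "0 \<le> z" "x + y + z = 1" "1 = y / 2 + z" "t = z * s"
    unfolding fan_def convex_hull_3 by auto
  then have "z = 1" by linarith
  with \<open>t = z * s\<close> show ?thesis by simp
qed

lemma ray_line:
  assumes "w \<in> ray s i"
  shows "(fst w - foot i) * s = snd w * (1 - foot i)"
proof -
  from assms obtain x y z where xyz: "x + y + z = 1"
      "w = x *\<^sub>R (foot i, 0) + y *\<^sub>R (1, s) + z *\<^sub>R (1, s)"
    unfolding ray_def convex_hull_3 by blast
  then have x: "x = 1 - y - z" by simp
  have "(fst (x *\<^sub>R (d, 0) + y *\<^sub>R (1, s) + z *\<^sub>R (1, s)) - d) * s =
      snd (x *\<^sub>R (d, 0 :: real) + y *\<^sub>R (1, s) + z *\<^sub>R (1, s)) * (1 - d)" for d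
    unfolding x by (simp add: algebra_simps)
  then show ?thesis unfolding xyz(2) .
qed


section \<open>Playing the fans against a rectangle choice\<close>

text \<open>A late switch is invisible on any given stage, so plays that switch ever later converge
  to \<open>A\<close>.\<close>

definition switch_at :: "(nat \<Rightarrow> 'a set) \<Rightarrow> nat \<Rightarrow> 'a set \<Rightarrow> nat \<Rightarrow> 'a set" where
  "switch_at A n S k = (if k < n then A k else S)"

lemma switch_at:
  assumes "strategy A" "S \<in> triangles" "S \<subseteq> (\<Inter>k. A k)"
  shows "strategy (switch_at A n S)" "(\<Inter>k. switch_at A n S k) = S"
proof -
  show Int: "(\<Inter>k. switch_at A n S k) = S"
    using assms(3) by (auto simp: switch_at_def split: if_splits)
  have "antimono A" "range A \<subseteq> triangles" using assms(1) by (auto simp: strategy_def)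
  then have "antimono (switch_at A n S)" "range (switch_at A n S) \<subseteq> triangles"
    using assms(2,3) by (auto simp: switch_at_def monotone_def)
  moreover have "switch_at A n S n = (\<Inter>k. switch_at A n S k)" unfolding Int by (simp add: switch_at_def)
  ultimately show "strategy (switch_at A n S)" unfolding strategy_def by blast
qed

lemma switch_at_conv:
  assumes "\<And>n. n \<le> m n"
  shows "\<forall>\<^sub>F n in sequentially. switch_at A (m n) (S n) k = A k"
proof -
  have "\<forall>\<^sub>F n in sequentially. k < n" by (rule eventually_gt_at_top)
  then show ?thesis
  proof eventually_elim
    case (elim n)
    with assms[of n] show ?case by (simp add: switch_at_def)
  qed
qed

lemma tendsto_close:
  fixes x y :: "nat \<Rightarrow> 'a::metric_space"
  assumes "x \<longlonglongrightarrow> c" "strict_mono k" "\<And>n. dist (x n) (y n) < inverse (real (Suc (k n)))"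
  shows "y \<longlonglongrightarrow> c"
proof -
  have "(\<lambda>n. inverse (real (Suc (k n)))) \<longlonglongrightarrow> 0"
    using LIMSEQ_subseq_LIMSEQ[OF LIMSEQ_inverse_real_of_nat assms(2)] by (simp add: comp_def)
  then have "(\<lambda>n. dist (x n) (y n)) \<longlonglongrightarrow> 0"
    by (rule Lim_null_comparison[rotated]) (use assms(3) in \<open>auto simp: less_imp_le\<close>)
  moreover have "(\<lambda>n. dist (x n) c) \<longlonglongrightarrow> 0" using assms(1) by (simp add: tendsto_dist_iff[symmetric])
  ultimately have "(\<lambda>n. dist (x n) (y n) + dist (x n) c) \<longlonglongrightarrow> 0" by (rule tendsto_add_zero)
  then have "(\<lambda>n. dist (y n) c) \<longlonglongrightarrow> 0"
    by (rule Lim_null_comparison[rotated]) (simp add: dist_triangle3)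
  then show ?thesis by (simp add: tendsto_dist_iff[symmetric])
qed

section \<open>Late switches and their limit rectangles\<close>

context rectangle_choice
begin

text \<open>Otherwise ever later switches leave points at distance at least \<open>e\<close> from
  the rectangle of \<open>A\<close>. By compactness they accumulate, and \<open>box_limit\<close>
  puts the accumulation point into that rectangle.\<close>

lemma box_switch_near:
  assumes A: "strategy A" and S: "S \<in> triangles" "S \<subseteq> (\<Inter>k. A k)" and "e > 0"
  shows "\<exists>m\<ge>n. \<forall>x\<in>cbox (lo (switch_at A m S)) (hi (switch_at A m S)). \<exists>y\<in>cbox (lo A) (hi A). dist x y < e"
proof (rule ccontr)
  assume neg: "\<not> ?thesis"
  let ?B = "\<lambda>m. switch_at A (n + m) S"
  have "\<exists>x\<in>cbox (lo (?B m)) (hi (?B m)). \<forall>y\<in>cbox (lo A) (hi A). e \<le> dist x y" for m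
    using neg by (force simp: not_less)
  then obtain X where X: "\<And>m. X m \<in> cbox (lo (?B m)) (hi (?B m))"
      "\<And>m y. y \<in> cbox (lo A) (hi A) \<Longrightarrow> e \<le> dist (X m) y" by metis
  have B: "strategy (?B m)" for m by (rule switch_at[OF A S])
  have "X m \<in> cbox (0, 0) (1, 1)" for m using X(1) box_unit[OF B] by blast
  then obtain c k where k: "strict_mono (k :: nat \<Rightarrow> nat)" "(X \<circ> k) \<longlonglongrightarrow> c"
    using compact_cbox[of "(0, 0) :: real \<times> real" "(1, 1)"] unfolding compact_def by blast
  have lim: "\<forall>\<^sub>F m in sequentially. ?B (k m) j = A j" for j
    by (rule switch_at_conv) (use k(1) seq_suble trans_le_add2 in blast)
  have "c \<in> cbox (lo A) (hi A)" by (rule box_limit[OF B A lim X(1) k(2)[unfolded comp_def]])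
  then have "e \<le> dist ((X \<circ> k) m) c" for m using X(2) by simp
  moreover have "\<forall>\<^sub>F m in sequentially. dist ((X \<circ> k) m) c < e" using tendstoD[OF k(2) \<open>e > 0\<close>] .
  ultimately show False by (simp add: not_less[symmetric])
qed

abbreviation "start \<equiv> (\<lambda>_::nat. base)"

lemma strategy_start: "strategy start"
  unfolding strategy_def base_def by (auto simp: antimono_def intro!: triangleI)

text \<open>The play moves from \<open>base\<close> to \<open>fan s\<close> at stage
  \<open>n\<close> (\<open>B\<close>), then to a ray (\<open>C\<close>), then to one of its two ends
  (\<open>D\<close>, \<open>E\<close>). The rectangles of \<open>C\<close> and the points chosen for
  \<open>D\<close> and \<open>E\<close> are only nearly inside the preceding rectangle, so the boxes
  are limits along a subsequence. All these plays converge stagewise to \<open>start\<close>, which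
  turns their forced answers into values of the single function \<open>F start\<close>.\<close>

lemma fan_boxes:
  assumes s: "s \<in> {0..1}"
  obtains l u a b z q where "cbox l u \<subseteq> cbox (lo start) (hi start)"
    "F start ` cbox l u \<subseteq> fan s" "traces_pencil (F start) s l u a b z q"
proof -
  have fan: "fan s \<in> triangles" "fan s \<subseteq> (\<Inter>k. start k)"
    using s fan_subset_base[OF s] by (auto simp: fan_def intro!: triangleI)
  have ray: "ray s i \<in> triangles" for i
    unfolding ray_def using s foot_unit[of i] by (intro triangleI) auto
  define B where "B n = switch_at start n (fan s)" for n
  have B: "strategy (B n)" "(\<Inter>k. B n k) = fan s" for n
    unfolding B_def by (rule switch_at[OF strategy_start fan])+
  have "\<exists>m\<ge>n. \<forall>x\<in>cbox (lo (switch_at (B n) m (ray s i))) (hi (switch_at (B n) m (ray s i))).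
      \<exists>y\<in>cbox (lo (B n)) (hi (B n)). dist x y < inverse (real (Suc n))" for n i
    by (rule box_switch_near[OF B(1) ray]) (simp_all add: B(2) ray_subset_fan)
  then obtain mC where mC: "\<And>n i. n \<le> mC n i"
      "\<And>n i x. x \<in> cbox (lo (switch_at (B n) (mC n i) (ray s i))) (hi (switch_at (B n) (mC n i) (ray s i))) \<Longrightarrow>
        \<exists>y\<in>cbox (lo (B n)) (hi (B n)). dist x y < inverse (real (Suc n))" by metis
  define C where "C n i = switch_at (B n) (mC n i) (ray s i)" for n i
  have C: "strategy (C n i)" "(\<Inter>k. C n i k) = ray s i" for n i
    unfolding C_def using ray_subset_fan by (intro switch_at[OF B(1) ray]; simp add: B(2))+
  have C_near: "\<exists>y\<in>cbox (lo (B n)) (hi (B n)). dist x y < inverse (real (Suc n))"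
    if "x \<in> cbox (lo (C n i)) (hi (C n i))" for n i x
    using mC(2) that unfolding C_def .
  \<comment> \<open>\<open>Z\<close> shrinks \<open>C n i\<close> to the single point
    \<open>w\<close>, so \<open>F_in\<close> forces the answer \<open>w\<close> at \<open>x\<close>.
    Following \<open>C n i\<close> before stage \<open>n\<close> lets \<open>Z\<close> converge to
    \<open>start\<close> as well.\<close>
  define marks where "marks n i w Z x \<longleftrightarrow> strategy Z \<and> (\<Inter>k. Z k) = {w} \<and> (\<forall>k<n. Z k = C n i k) \<and>
      x \<in> cbox (lo Z) (hi Z) \<and> (\<exists>y\<in>cbox (lo (C n i)) (hi (C n i)). dist x y < inverse (real (Suc n)))"
    for n i w x and Z :: "nat \<Rightarrow> (real \<times> real) set"
  have point: "\<exists>Z x. marks n i w Z x" if w: "w \<in> ray s i" for w n i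
  proof -
    have tri: "{w} \<in> triangles" using w triangleE(4)[OF ray] by (intro singleton_triangle) blast
    have sub: "{w} \<subseteq> (\<Inter>k. C n i k)" using w C(2) by simp
    have "\<exists>m\<ge>n. \<forall>x\<in>cbox (lo (switch_at (C n i) m {w})) (hi (switch_at (C n i) m {w})).
      \<exists>y\<in>cbox (lo (C n i)) (hi (C n i)). dist x y < inverse (real (Suc n))"
      by (rule box_switch_near[OF C(1) tri sub]) simp
    then obtain m where m: "m \<ge> n" "\<And>x. x\<in>cbox (lo (switch_at (C n i) m {w})) (hi (switch_at (C n i) m {w})) \<Longrightarrow>
      \<exists>y\<in>cbox (lo (C n i)) (hi (C n i)). dist x y < inverse (real (Suc n))" by blast
    let ?Z = "switch_at (C n i) m {w}"
    have Z: "strategy ?Z" "(\<Inter>k. ?Z k) = {w}" by (rule switch_at[OF C(1) tri sub])+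
    moreover have "\<forall>k<n. ?Z k = C n i k" using m(1) by (simp add: switch_at_def)
    moreover have lo: "lo ?Z \<in> cbox (lo ?Z) (hi ?Z)" using box_nonempty[OF Z(1)] by (rule cbox_corners_mem)
    ultimately show ?thesis unfolding marks_def
      by (intro exI[of _ ?Z] exI[of _ "lo ?Z"] conjI m(2)[OF lo])
  qed
  have apex: "(1, s) \<in> ray s i" and foot: "(foot i, 0) \<in> ray s i" for i
    unfolding ray_def by (rule hull_inc, simp)+
  from point[OF apex] obtain D z where "\<And>n i. marks n i (1, s) (D n i) (z n i)" by metis
  then have D: "\<And>n i. strategy (D n i)" "\<And>n i. (\<Inter>k. D n i k) = {(1, s)}"
      "\<And>n i k. k < n \<Longrightarrow> D n i k = C n i k" "\<And>n i. z n i \<in> cbox (lo (D n i)) (hi (D n i))"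
      "\<And>n i. \<exists>y\<in>cbox (lo (C n i)) (hi (C n i)). dist (z n i) y < inverse (real (Suc n))"
    unfolding marks_def by simp_all
  from point[OF foot] obtain E q where "\<And>n i. marks n i (foot i, 0) (E n i) (q n i)" by metis
  then have E: "\<And>n i. strategy (E n i)" "\<And>n i. (\<Inter>k. E n i k) = {(foot i, 0)}"
      "\<And>n i k. k < n \<Longrightarrow> E n i k = C n i k" "\<And>n i. q n i \<in> cbox (lo (E n i)) (hi (E n i))"
      "\<And>n i. \<exists>y\<in>cbox (lo (C n i)) (hi (C n i)). dist (q n i) y < inverse (real (Suc n))"
    unfolding marks_def by simp_all
  have corners: "lo A \<in> cbox (0, 0) (1, 1)" "hi A \<in> cbox (0, 0) (1, 1)" if "strategy A" for A
    using cbox_corners_mem[OF box_nonempty[OF that]] box_unit[OF that] by blast+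
  have "z n i \<in> cbox (0, 0) (1, 1)" "q n i \<in> cbox (0, 0) (1, 1)" for n i
    using D(4) E(4) box_unit[OF D(1)] box_unit[OF E(1)] by blast+
  then obtain k l u a b z' q' where
    k: "strict_mono (k :: nat \<Rightarrow> nat)"
    and l: "(\<lambda>n. lo (B (k n))) \<longlonglongrightarrow> l" and u: "(\<lambda>n. hi (B (k n))) \<longlonglongrightarrow> u"
    and a: "\<And>i. (\<lambda>n. lo (C (k n) i)) \<longlonglongrightarrow> a i" and b: "\<And>i. (\<lambda>n. hi (C (k n) i)) \<longlonglongrightarrow> b i"
    and z': "\<And>i. (\<lambda>n. z (k n) i) \<longlonglongrightarrow> z' i" and q': "\<And>i. (\<lambda>n. q (k n) i) \<longlonglongrightarrow> q' i"
    by (rule convergent_boxes[of "\<lambda>n. lo (B n)" "\<lambda>n. hi (B n)" "\<lambda>n i. lo (C n i)" "\<lambda>n i. hi (C n i)" z q,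
          OF corners[OF B(1)] corners[OF C(1)]]) (rule that)
  have kn: "n \<le> k n" for n using k by (rule seq_suble)
  have agreeB: "B (k n) j = base" if "j < n" for n j
    using that kn[of n] by (simp add: B_def switch_at_def)
  have agreeC: "C (k n) i j = base" if "j < n" for n i j
    using that kn[of n] mC(1)[of "k n" i] agreeB[OF that] by (simp add: C_def switch_at_def)
  \<comment> \<open>Every switch made for index \<open>k n\<close> happens at stage
    \<open>k n\<close> or later, and \<open>n \<le> k n\<close>.\<close>
  have agree: "\<forall>\<^sub>F n in sequentially. D (k n) i j = base" "\<forall>\<^sub>F n in sequentially. E (k n) i j = base"
      "\<forall>\<^sub>F n in sequentially. C (k n) i j = base" "\<forall>\<^sub>F n in sequentially. B (k n) j = base" for i j
    using kn agreeB agreeC D(3) E(3)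
    by (auto intro!: eventually_mono[OF eventually_gt_at_top[of j]] simp: less_le_trans[OF _ kn])
  have z_C: "z' i \<in> cbox (a i) (b i)" and q_C: "q' i \<in> cbox (a i) (b i)" for i
  proof -
    have "\<forall>n. \<exists>y. y \<in> cbox (lo (C (k n) i)) (hi (C (k n) i)) \<and> dist (z (k n) i) y < inverse (real (Suc (k n)))"
      using D(5) by blast
    then obtain y where y: "\<And>n. y n \<in> cbox (lo (C (k n) i)) (hi (C (k n) i))"
        "\<And>n. dist (z (k n) i) (y n) < inverse (real (Suc (k n)))" by metis
    show "z' i \<in> cbox (a i) (b i)" by (rule cbox_limit_mem[OF a b tendsto_close[OF z' k y(2)] y(1)])
    have "\<forall>n. \<exists>y. y \<in> cbox (lo (C (k n) i)) (hi (C (k n) i)) \<and> dist (q (k n) i) y < inverse (real (Suc (k n)))"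
      using E(5) by blast
    then obtain y where y: "\<And>n. y n \<in> cbox (lo (C (k n) i)) (hi (C (k n) i))"
        "\<And>n. dist (q (k n) i) (y n) < inverse (real (Suc (k n)))" by metis
    show "q' i \<in> cbox (a i) (b i)" by (rule cbox_limit_mem[OF a b tendsto_close[OF q' k y(2)] y(1)])
  qed
  \<comment> \<open>The answers along the sequence are constantly \<open>(1, s)\<close>, hence so is
    their limit, the value of \<open>F start\<close>.\<close>
  have f_z: "F start (z' i) = (1, s)" for i
  proof -
    have "(\<lambda>n. F (D (k n) i) (z (k n) i)) \<longlonglongrightarrow> F start (z' i)"
      by (rule F_limit[OF D(1) strategy_start agree(1) D(4) z'])
    moreover have "F (D (k n) i) (z (k n) i) = (1, s)" for n
      using F_in[OF D(1) D(4)] unfolding D(2) by blast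
    ultimately show ?thesis by (simp add: LIMSEQ_const_iff)
  qed
  have f_q: "F start (q' i) = (foot i, 0)" for i
  proof -
    have "(\<lambda>n. F (E (k n) i) (q (k n) i)) \<longlonglongrightarrow> F start (q' i)"
      by (rule F_limit[OF E(1) strategy_start agree(2) E(4) q'])
    moreover have "F (E (k n) i) (q (k n) i) = (foot i, 0)" for n
      using F_in[OF E(1) E(4)] unfolding E(2) by blast
    ultimately show ?thesis by (simp add: LIMSEQ_const_iff)
  qed
  \<comment> \<open>Every point of the limit box is a limit of points of the rectangles of
    \<open>C (k n) i\<close>, where the answers lie in the closed ray.\<close>
  have C_box: "x \<in> cbox l u \<and> F start x \<in> ray s i" if x: "x \<in> cbox (a i) (b i)" for x i
  proof
    obtain X where X: "X \<longlonglongrightarrow> x" "\<And>n. X n \<in> cbox (lo (C (k n) i)) (hi (C (k n) i))"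
      using cbox_limit_approx[OF a b box_nonempty[OF C(1)] x] by blast
    obtain y where y: "\<And>n. y n \<in> cbox (lo (B (k n))) (hi (B (k n)))"
        "\<And>n. dist (X n) (y n) < inverse (real (Suc (k n)))" using C_near[OF X(2)] by metis
    show "x \<in> cbox l u" by (rule cbox_limit_mem[OF l u tendsto_close[OF X(1) k y(2)] y(1)])
    show "F start x \<in> ray s i"
    proof (rule Lim_in_closed_set[OF triangleE(1)[OF ray] _ _ F_limit[OF C(1) strategy_start agree(3) X(2,1)]])
      show "\<forall>\<^sub>F n in sequentially. F (C (k n) i) (X n) \<in> ray s i"
        using F_in[OF C(1) X(2)] unfolding C(2) by simp
    qed simp
  qed
  have B_box: "x \<in> cbox (lo start) (hi start) \<and> F start x \<in> fan s" if x: "x \<in> cbox l u" for x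
  proof
    obtain X where X: "X \<longlonglongrightarrow> x" "\<And>n. X n \<in> cbox (lo (B (k n))) (hi (B (k n)))"
      using cbox_limit_approx[OF l u box_nonempty[OF B(1)] x] by blast
    show "x \<in> cbox (lo start) (hi start)" by (rule box_limit[OF B(1) strategy_start agree(4) X(2,1)])
    show "F start x \<in> fan s"
    proof (rule Lim_in_closed_set[OF triangleE(1)[OF fan(1)] _ _ F_limit[OF B(1) strategy_start agree(4) X(2,1)]])
      show "\<forall>\<^sub>F n in sequentially. F (B (k n)) (X n) \<in> fan s"
        using F_in[OF B(1) X(2)] unfolding B(2) by simp
    qed simp
  qed
  show thesis
  proof (rule that)
    show "cbox l u \<subseteq> cbox (lo start) (hi start)" "F start ` cbox l u \<subseteq> fan s"
      using B_box by blast+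
    show "traces_pencil (F start) s l u a b z' q'"
      unfolding traces_pencil_def
    proof (intro allI conjI ballI)
      show "cbox (a i) (b i) \<subseteq> cbox l u" for i using C_box by blast
      show "(fst (F start x) - foot i) * s = snd (F start x) * (1 - foot i)" if "x \<in> cbox (a i) (b i)" for i x
        using C_box[OF that] ray_line by blast
    qed (rule z_C q_C f_z f_q)+
  qed
qed

lemma F_start_continuous: "continuous_on (cbox (lo start) (hi start)) (F start)"
  unfolding continuous_on_sequentially comp_def
  using F_limit[of "\<lambda>_. start" start] strategy_start by auto

text \<open>All limit rectangles lie in one rectangle and carry the same function
  \<open>F start\<close>, so those for different apexes can be compared. Along a convergent
  subsequence a marked point falls into the rectangle of another apex, whose fan misses its
  value.\<close>

lemma rectangle_choice_False: False
proof -
  let ?f = "F start"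
  \<comment> \<open>Distinct apex heights with a limit. The double \<open>Suc\<close> keeps
    \<open>s 0 = 1\<close> in the unit interval, and the offset 1/2 keeps the limit height nonzero,
    as \<open>traces_pencil_no_corner\<close> demands.\<close>
  define s where "s n = 1/2 + inverse (real (Suc (Suc n)))" for n
  have s: "s n \<in> {0..1}" for n by (auto simp: s_def field_simps)
  have inj: "s n \<noteq> s m" if "n \<noteq> m" for n m using that by (simp add: s_def)
  have "\<exists>l u a b z q. cbox l u \<subseteq> cbox (lo start) (hi start) \<and> ?f ` cbox l u \<subseteq> fan (s n) \<and>
      traces_pencil ?f (s n) l u a b z q" for n
    using fan_boxes[OF s[of n]] by metis
  then obtain l u a b z q where sub: "\<And>n. cbox (l n) (u n) \<subseteq> cbox (lo start) (hi start)"
      and fan: "\<And>n. ?f ` cbox (l n) (u n) \<subseteq> fan (s n)"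
      and tr: "\<And>n. traces_pencil ?f (s n) (l n) (u n) (a n) (b n) (z n) (q n)" by metis
  have ab: "cbox (a n i) (b n i) \<subseteq> cbox (l n) (u n)" and z: "z n i \<in> cbox (a n i) (b n i)" "?f (z n i) = (1, s n)"
    and q: "q n i \<in> cbox (a n i) (b n i)" "?f (q n i) = (foot i, 0)"
    and line: "\<And>x. x \<in> cbox (a n i) (b n i) \<Longrightarrow> (fst (?f x) - foot i) * s n = snd (?f x) * (1 - foot i)" for n i
    using tr[of n, unfolded traces_pencil_def, THEN spec, of i] by simp_all
  have ne: "cbox (a n i) (b n i) \<noteq> {}" "cbox (l n) (u n) \<noteq> {}" for n i using z(1) ab by blast+
  have unit: "cbox (l n) (u n) \<subseteq> cbox (0, 0) (1, 1)" for n using sub box_unit[OF strategy_start] by blast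
  have corner: "c \<in> cbox (0, 0) (1, 1)" "d \<in> cbox (0, 0) (1, 1)"
    if "cbox c d \<noteq> {}" "cbox c d \<subseteq> cbox (0, 0) (1, 1)" for c d :: "real \<times> real"
    using cbox_corners_mem[OF that(1)] that(2) by blast+
  have ab_unit: "a n i \<in> cbox (0, 0) (1, 1)" "b n i \<in> cbox (0, 0) (1, 1)" for n i
    using corner[OF ne(1)] ab unit by blast+
  have zq_unit: "z n i \<in> cbox (0, 0) (1, 1)" "q n i \<in> cbox (0, 0) (1, 1)" for n i
    using z(1) q(1) ab unit by blast+
  obtain k l' u' a' b' z' q' where k: "strict_mono (k :: nat \<Rightarrow> nat)"
    and l': "(\<lambda>n. l (k n)) \<longlonglongrightarrow> l'" and u': "(\<lambda>n. u (k n)) \<longlonglongrightarrow> u'"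
    and a': "\<And>i. (\<lambda>n. a (k n) i) \<longlonglongrightarrow> a' i" and b': "\<And>i. (\<lambda>n. b (k n) i) \<longlonglongrightarrow> b' i"
    and z': "\<And>i. (\<lambda>n. z (k n) i) \<longlonglongrightarrow> z' i" and q': "\<And>i. (\<lambda>n. q (k n) i) \<longlonglongrightarrow> q' i"
    by (rule convergent_boxes[of l u a b z q, OF corner[OF ne(2) unit] ab_unit zq_unit]) (rule that)
  have "(\<lambda>n. s n) \<longlonglongrightarrow> 1/2 + 0"
    unfolding s_def by (intro tendsto_add tendsto_const LIMSEQ_Suc[OF LIMSEQ_inverse_real_of_nat])
  then have s': "(\<lambda>n. s (k n)) \<longlonglongrightarrow> 1/2" using LIMSEQ_subseq_LIMSEQ[OF _ k] by (fastforce simp: comp_def)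
  have in_start: "x \<in> cbox (lo start) (hi start)" if "x \<in> cbox (l n) (u n)" for x n using sub that by blast
  have f_lim: "(\<lambda>n. ?f (X n)) \<longlonglongrightarrow> ?f x" if "X \<longlonglongrightarrow> x" "\<And>n. X n \<in> cbox (l (k n)) (u (k n))" for X x
    by (rule F_limit[OF strategy_start strategy_start _ in_start[OF that(2)] that(1)]) simp
  have lu': "x \<in> cbox (lo start) (hi start)" if x: "x \<in> cbox l' u'" for x
  proof -
    obtain X where X: "X \<longlonglongrightarrow> x" "\<And>n. X n \<in> cbox (l (k n)) (u (k n))"
      using cbox_limit_approx[OF l' u' ne(2) x] by blast
    show ?thesis by (rule cbox_limit_mem[OF tendsto_const tendsto_const X(1) in_start[OF X(2)]])
  qed
  have z_lu: "z (k n) i \<in> cbox (l (k n)) (u (k n))" and q_lu: "q (k n) i \<in> cbox (l (k n)) (u (k n))" for n i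
    using z(1) q(1) ab by blast+
  \<comment> \<open>The conditions are equations and weak inequalities in convergent data, and
    \<open>F start\<close> is continuous, so they pass to the limit.\<close>
  have "traces_pencil ?f (1/2) l' u' a' b' z' q'"
    unfolding traces_pencil_def
  proof (intro allI conjI ballI subsetI)
    fix i
    show "z' i \<in> cbox (a' i) (b' i)" by (rule cbox_limit_mem[OF a' b' z' z(1)])
    show "q' i \<in> cbox (a' i) (b' i)" by (rule cbox_limit_mem[OF a' b' q' q(1)])
    show "?f (z' i) = (1, 1/2)"
      using f_lim[OF z' z_lu] tendsto_Pair[OF tendsto_const s'] unfolding z(2) by (rule LIMSEQ_unique)
    show "?f (q' i) = (foot i, 0)"
      using f_lim[OF q' q_lu] tendsto_const unfolding q(2) by (rule LIMSEQ_unique)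
    fix x assume x: "x \<in> cbox (a' i) (b' i)"
    obtain X where X: "X \<longlonglongrightarrow> x" "\<And>n. X n \<in> cbox (a (k n) i) (b (k n) i)"
      using cbox_limit_approx[OF a' b' ne(1) x] by blast
    have X_lu: "X n \<in> cbox (l (k n)) (u (k n))" for n using X(2) ab by blast
    show "x \<in> cbox l' u'" by (rule cbox_limit_mem[OF l' u' X(1) X_lu])
    have "(\<lambda>n. (fst (?f (X n)) - foot i) * s (k n)) \<longlonglongrightarrow> (fst (?f x) - foot i) * (1/2)"
      by (intro tendsto_mult tendsto_diff tendsto_fst tendsto_const s' f_lim[OF X(1) X_lu])
    moreover have "(\<lambda>n. snd (?f (X n)) * (1 - foot i)) \<longlonglongrightarrow> snd (?f x) * (1 - foot i)"
      by (intro tendsto_mult tendsto_snd tendsto_const f_lim[OF X(1) X_lu])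
    ultimately show "(fst (?f x) - foot i) * (1/2) = snd (?f x) * (1 - foot i)"
      unfolding line[OF X(2)] by (rule LIMSEQ_unique)
  qed
  moreover have "cbox l' u' \<subseteq> cbox (lo start) (hi start)" using lu' by blast
  moreover from this have "cbox l' u' \<subseteq> cbox (0, 0) (1, 1)" "continuous_on (cbox l' u') ?f"
    using box_unit[OF strategy_start] F_start_continuous continuous_on_subset by blast+
  ultimately have proper: "fst l' < fst u'" "snd l' < snd u'"
      and "\<exists>i. fst (z' i) \<notin> {fst l', fst u'} \<or> snd (z' i) \<notin> {snd l', snd u'}"
    by (intro traces_pencil_no_corner[of ?f "1/2" l' u' a' b' z' q']; simp)+
  then obtain i where i: "fst (z' i) \<notin> {fst l', fst u'} \<or> snd (z' i) \<notin> {snd l', snd u'}" by blast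
  obtain N where N: "\<And>n m. n \<ge> N \<Longrightarrow> m \<ge> N \<Longrightarrow>
      z (k n) i \<in> cbox (l (k m)) (u (k m)) \<or> z (k m) i \<in> cbox (l (k n)) (u (k n))"
    using box_sequences_overlap[OF l' u' z' z_lu proper i] by blast
  \<comment> \<open>The value \<open>(1, s (k n))\<close> would lie in a fan whose only point with
    first coordinate 1 is a different apex.\<close>
  have clash: False if "z (k n) i \<in> cbox (l (k m)) (u (k m))" "n \<noteq> m" for n m
  proof -
    have "?f (z (k n) i) \<in> fan (s (k m))" using that(1) fan by blast
    then have "s (k n) = s (k m)" unfolding z(2) by (rule fan_apex)
    then have "k n = k m" using inj by blast
    with k that(2) show False by (simp add: strict_mono_eq)
  qed
  from N[of N "Suc N"] clash[of N "Suc N"] clash[of "Suc N" N] show False by auto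
qed

end

theorem theorem28: "\<not> problem_restrict XC\<^sub>2 triangles \<le>\<^sub>W XC\<^sub>1 \<times>\<^sub>W XC\<^sub>1"
proof
  assume "problem_restrict XC\<^sub>2 triangles \<le>\<^sub>W XC\<^sub>1 \<times>\<^sub>W XC\<^sub>1"
  then obtain H K where "computable H" "computable K" "\<And>G. G \<turnstile> XC\<^sub>1 \<times>\<^sub>W XC\<^sub>1 \<Longrightarrow>
      (\<lambda>p. Option.bind (H p) (\<lambda>h. Option.bind (G h) (\<lambda>r. K (baire_pair p r))))
        \<turnstile> problem_restrict XC\<^sub>2 triangles"
    unfolding weihrauch_le_def by blast
  then interpret triangle_reduction H K by unfold_locales
  show False by (rule rectangle_choice_False)
qed

end
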